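(* (i) Let $\Omega\subset\mathbb{R}^n$ be a non-empty open convex domain. Suppose $f:\Omega\to\mathbb{R}$ is a locally semiconvex function in $\Omega$ (with general modulus), and let $x_0\in\Omega$ be a non-differentiable (singular) point of $f$. Then for every bounded open set $G\subset\Omega$ such that $x_0\in G\subset\bar G\subset\Omega$, $$\lim_{\lambda\to+\infty}\lambda V_{\lambda,G}(f)(x_0)=\frac{r_{x_0}^2}{4},$$ where $r_{x_0}>0$ is the radius of the minimal bounding sphere of the Fréchet subdifferential $\partial_-f(x_0)$ of $f$ at $x_0$. (ii) Let $\Omega\subset\mathbb{R}^n$ be a non-empty open convex domain. Assume that $f:\Omega\to\mathbb{R}$ is a locally semiconvex function with linear modulus in $\Omega$, i.e. on every convex compact subset $K$ of $\Omega$ there exists $\lambda_K\ge 0$ such that $f(x)=g_K(x)-\lambda_K|x|^2$ for $x\in K$, where $g_K:K\to\mathbb{R}$ is a convex continuous function on $K$, and let $x_0\in\Omega$ be a non-differentiable (singular) point of $f$. Then for every bounded open set $G\subset\Omega$ such that $x_0\in G\subset\bar G\subset\Omega$, $$\lim_{\lambda\to+\infty}\nabla C^u_{\lambda,G}(f)(x_0)=y_0,$$ where $y_0\in\partial_-f(x_0)$ is the centre of the minimal bounding sphere of $\partial_-f(x_0)$.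
   Context: $|\cdot|$ is the Euclidean norm and $x\cdot y$ the standard inner product on $\mathbb{R}^n$. $\mathsf{co}[g]$ denotes the convex envelope of $g:\mathbb{R}^n\to(-\infty,+\infty]$, i.e. the largest convex function not exceeding $g$. Upper compensated convex transform: for $F:\mathbb{R}^n\to\mathbb{R}$ of linear growth and $\lambda>0$, $C^u_\lambda(F)(x)=\lambda|x|^2-\mathsf{co}[\lambda|\cdot|^2-F](x)$. Valley transform: $V_\lambda(F)(x)=C^u_\lambda(F)(x)-F(x)$. Semiconvexity: a function $f$ is semiconvex on a convex set $K$ with modulus $\omega$ if $\omega:[0,+\infty)\to[0,+\infty)$ is non-decreasing, upper semicontinuous, $\lim_{t\to0+}\omega(t)=0$, and $$sf(x)+(1-s)f(y)-f(sx+(1-s)y)\ge -s(1-s)|x-y|\,\omega(|x-y|)$$ for all $x,y\in K$, $0\le s\le1$. $f:\Omega\to\mathbb{R}$ is locally semiconvex in $\Omega$ if on every convex compact set $K\subset\Omega$ it is semiconvex with some modulus $\omega_K$ depending on $K$. A locally semiconvex function is Lipschitz on every compact subset of $\Omega$. Local transforms: let $f:\Omega\to\mathbb{R}$ be locally Lipschitz and $G$ a bounded open set with $\bar G\subset\Omega$. Let $L_G$ be the Lipschitz constant of $f|_{\bar G}$ and let $f_G:\mathbb{R}^n\to\mathbb{R}$ be any Lipschitz extension of $f|_{\bar G}$ to $\mathbb{R}^n$ with the same constant $L_G$ (it exists by Kirszbraun's theorem; the results do not depend on its choice). Define $C^u_{\lambda,G}(f)=C^u_\lambda(f_G)$ and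 $V_{\lambda,G}(f)=V_\lambda(f_G)$. Fréchet subdifferential: for $f:\Omega\to\mathbb{R}$ locally semiconvex and $x\in\Omega$, let $K$ be a bounded open convex set with $x\in K\subset\bar K\subset\Omega$ and $\omega_K$ a semiconvexity modulus of $f$ in $K$. Then $\partial_-f(x)$ is the set of $p\in\mathbb{R}^n$ with $f(y)-f(x)-p\cdot(y-x)\ge-|y-x|\,\omega_K(|y-x|)$ for every $y$ such that the segment with ends $x,y$ lies in $K$. It does not depend on $K$ and is a non-empty compact convex set. Minimal bounding sphere: every non-empty compact $K\subset\mathbb{R}^n$ is contained in a unique closed ball of smallest radius; the boundary sphere of this ball is the minimal bounding sphere of $K$, with the same centre and radius. The gradient limit in (ii) is taken along all sufficiently large $\lambda$; the assertion includes that $C^u_{\lambda,G}(f)$ is differentiable at $x_0$ for such $\lambda$. *)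

theory Defs
  imports "HOL-Analysis.Analysis"
begin

section \<open>Compensated convex transforms\<close>

text \<open>Only real-valued \<open>g\<close> occur here, and a convex function below a real-valued one never
  takes the value \<open>+\<infinity>\<close>, so real-valued convex minorants suffice. If \<open>g\<close> has no convex
  minorant the value is meaningless.\<close>

definition convex_envelope :: "('a::real_vector \<Rightarrow> real) \<Rightarrow> 'a \<Rightarrow> real" where
  "convex_envelope g x = Sup {h x |h. convex_on UNIV h \<and> (\<forall>y. h y \<le> g y)}"

definition upper_transform :: "real \<Rightarrow> ('a::real_inner \<Rightarrow> real) \<Rightarrow> 'a \<Rightarrow> real" where
  "upper_transform \<mu> F x = \<mu> * (norm x)\<^sup>2 - convex_envelope (\<lambda>y. \<mu> * (norm y)\<^sup>2 - F y) x"

definition valley_transform :: "real \<Rightarrow> ('a::real_inner \<Rightarrow> real) \<Rightarrow> 'a \<Rightarrow> real" where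
  "valley_transform \<mu> F x = upper_transform \<mu> F x - F x"

definition lipschitz_const :: "'a::metric_space set \<Rightarrow> ('a \<Rightarrow> real) \<Rightarrow> real" where
  "lipschitz_const S f = Inf {L. L-lipschitz_on S f}"

text \<open>\<open>F\<close> is an admissible choice of \<open>f\<^sub>G\<close>; the transforms of \<open>f\<close> localised to \<open>G\<close> are the
  transforms of such an \<open>F\<close>.\<close>

definition lipschitz_extension :: "'a::metric_space set \<Rightarrow> ('a \<Rightarrow> real) \<Rightarrow> ('a \<Rightarrow> real) \<Rightarrow> bool" where
  "lipschitz_extension G f F \<longleftrightarrow>
     (\<forall>x\<in>closure G. F x = f x) \<and> (lipschitz_const (closure G) f)-lipschitz_on UNIV F"

lemma convex_envelope_greatest:
  assumes h0: "convex_on UNIV h0" "\<And>y. h0 y \<le> g y"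
  shows "convex_on UNIV (convex_envelope g)"
    and "convex_envelope g x \<le> g x"
    and "\<And>h. convex_on UNIV h \<Longrightarrow> (\<And>y. h y \<le> g y) \<Longrightarrow> h x \<le> convex_envelope g x"
proof -
  let ?S = "\<lambda>x. {h x |h. convex_on UNIV h \<and> (\<forall>y. h y \<le> g y)}"
  have ne: "?S x \<noteq> {}" for x
    using h0 by blast
  have bdd: "bdd_above (?S x)" for x
    by (rule bdd_aboveI[of _ "g x"]) auto
  show "convex_envelope g x \<le> g x"
    unfolding convex_envelope_def using ne by (intro cSup_least) auto
  have up: "h x \<le> convex_envelope g x" if "convex_on UNIV h" "\<And>y. h y \<le> g y" for h x
    unfolding convex_envelope_def using bdd that by (intro cSup_upper) auto
  show "\<And>h. convex_on UNIV h \<Longrightarrow> (\<And>y. h y \<le> g y) \<Longrightarrow> h x \<le> convex_envelope g x"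
    by (rule up)
  show "convex_on UNIV (convex_envelope g)"
    unfolding convex_on_def
  proof (intro conjI ballI allI impI)
    fix x y :: 'a and u v :: real
    assume uv: "0 \<le> u" "0 \<le> v" "u + v = 1"
    show "convex_envelope g (u *\<^sub>R x + v *\<^sub>R y) \<le> u * convex_envelope g x + v * convex_envelope g y"
      unfolding convex_envelope_def[of g "u *\<^sub>R x + v *\<^sub>R y"]
    proof (intro cSup_least ne)
      fix t assume "t \<in> ?S (u *\<^sub>R x + v *\<^sub>R y)"
      then obtain h where h: "convex_on UNIV h" "\<forall>y. h y \<le> g y" and t: "t = h (u *\<^sub>R x + v *\<^sub>R y)"
        by auto
      have "t \<le> u * h x + v * h y"
        using h(1) uv unfolding t convex_on_def by auto
      also have "\<dots> \<le> u * convex_envelope g x + v * convex_envelope g y"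
        using up[OF h(1)] h(2) uv by (intro add_mono mult_left_mono) auto
      finally show "t \<le> u * convex_envelope g x + v * convex_envelope g y" .
    qed
  qed auto
qed

lemma lipschitz_extension_exists:
  fixes f :: "'a::metric_space \<Rightarrow> real"
  assumes ne: "G \<noteq> {}" and L: "L-lipschitz_on (closure G) f"
  shows "\<exists>F. lipschitz_extension G f F"
proof -
  define C where "C = closure G"
  define M where "M = lipschitz_const C f"
  have C: "C \<noteq> {}" using ne by (simp add: C_def)
  have "L \<in> {L. L-lipschitz_on C f}" using L by (simp add: C_def)
  then have nonem: "{L. L-lipschitz_on C f} \<noteq> {}" by blast
  have M0: "0 \<le> M"
    unfolding M_def lipschitz_const_def using nonem
    by (intro cInf_greatest) (auto intro: lipschitz_on_nonneg)
  have fM: "\<bar>f x - f y\<bar> \<le> M * dist x y" if "x \<in> C" "y \<in> C" for x y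
  proof (cases "x = y")
    case False
    then have d: "0 < dist x y" by simp
    have "\<bar>f x - f y\<bar> / dist x y \<le> M"
      unfolding M_def lipschitz_const_def
    proof (intro cInf_greatest nonem)
      fix K assume "K \<in> {L. L-lipschitz_on C f}"
      then have "dist (f x) (f y) \<le> K * dist x y" using that lipschitz_onD by auto
      then show "\<bar>f x - f y\<bar> / dist x y \<le> K"
        using d by (simp add: dist_real_def pos_divide_le_eq)
    qed
    then show ?thesis using d by (simp add: pos_divide_le_eq)
  qed auto
  define F where "F x = (INF s\<in>C. f s + M * dist x s)" for x
  obtain s0 where s0: "s0 \<in> C" using C by blast
  have bdd: "bdd_below ((\<lambda>s. f s + M * dist x s) ` C)" for x
  proof (rule bdd_belowI2[of _ "f s0 - M * dist x s0"])
    fix s assume s: "s \<in> C"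
    have "M * dist s0 s \<le> M * (dist x s0 + dist x s)"
      using M0 by (intro mult_left_mono) (auto intro: dist_triangle3)
    then show "f s0 - M * dist x s0 \<le> f s + M * dist x s"
      using fM[OF s0 s] by (auto simp: algebra_simps abs_if split: if_splits)
  qed
  have ext: "F x = f x" if x: "x \<in> C" for x
  proof (rule antisym)
    show "F x \<le> f x"
      unfolding F_def using cINF_lower[OF bdd x, of x] by simp
    show "f x \<le> F x"
      unfolding F_def
    proof (intro cINF_greatest C)
      fix s assume "s \<in> C"
      then show "f x \<le> f s + M * dist x s"
        using fM[OF x, of s] by (auto simp: abs_if split: if_splits)
    qed
  qed
  have le: "F x \<le> F y + M * dist x y" for x y
  proof -
    have "F x - M * dist x y \<le> F y"
      unfolding F_def[of y]
    proof (intro cINF_greatest C)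
      fix s assume s: "s \<in> C"
      have "F x \<le> f s + M * dist x s"
        unfolding F_def using cINF_lower[OF bdd s] .
      also have "M * dist x s \<le> M * (dist x y + dist y s)"
        using M0 by (intro mult_left_mono dist_triangle)
      finally show "F x - M * dist x y \<le> f s + M * dist y s"
        by (simp add: algebra_simps)
    qed
    then show ?thesis by simp
  qed
  have "M-lipschitz_on UNIV F"
  proof (rule lipschitz_onI)
    fix x y
    show "dist (F x) (F y) \<le> M * dist x y"
      using le[of x y] le[of y x] by (simp add: dist_real_def dist_commute abs_le_iff)
  qed (rule M0)
  then show ?thesis
    using ext unfolding lipschitz_extension_def C_def M_def by blast
qed


section \<open>Semiconvexity\<close>

text \<open>A modulus is a function on \<open>[0,\<infinity>)\<close>; its values on negative arguments are irrelevant.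
  The last conjunct is upper semicontinuity on \<open>[0,\<infinity>)\<close>.\<close>

definition is_modulus :: "(real \<Rightarrow> real) \<Rightarrow> bool" where
  "is_modulus \<omega> \<longleftrightarrow>
     (\<forall>t\<ge>0. 0 \<le> \<omega> t) \<and>
     mono_on {0..} \<omega> \<and>
     (\<omega> \<longlongrightarrow> 0) (at_right 0) \<and>
     (\<forall>t\<ge>0. \<forall>a>\<omega> t. \<forall>\<^sub>F s in at t within {0..}. \<omega> s < a)"

definition semiconvex_on :: "'a::real_normed_vector set \<Rightarrow> (real \<Rightarrow> real) \<Rightarrow> ('a \<Rightarrow> real) \<Rightarrow> bool" where
  "semiconvex_on K \<omega> f \<longleftrightarrow>
     convex K \<and> is_modulus \<omega> \<and>
     (\<forall>x\<in>K. \<forall>y\<in>K. \<forall>s\<in>{0..1}.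
        s * f x + (1 - s) * f y - f (s *\<^sub>R x + (1 - s) *\<^sub>R y)
          \<ge> - s * (1 - s) * norm (x - y) * \<omega> (norm (x - y)))"

definition locally_semiconvex_on :: "'a::real_normed_vector set \<Rightarrow> ('a \<Rightarrow> real) \<Rightarrow> bool" where
  "locally_semiconvex_on \<Omega> f \<longleftrightarrow>
     (\<forall>K. convex K \<and> compact K \<and> K \<subseteq> \<Omega> \<longrightarrow> (\<exists>\<omega>. semiconvex_on K \<omega> f))"

definition locally_linear_semiconvex_on :: "'a::real_normed_vector set \<Rightarrow> ('a \<Rightarrow> real) \<Rightarrow> bool" where
  "locally_linear_semiconvex_on \<Omega> f \<longleftrightarrow>
     (\<forall>K. convex K \<and> compact K \<and> K \<subseteq> \<Omega> \<longrightarrow>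
        (\<exists>\<mu>\<ge>0. \<exists>g. convex_on K g \<and> continuous_on K g \<and> (\<forall>x\<in>K. f x = g x - \<mu> * (norm x)\<^sup>2)))"


section \<open>Frechet subdifferential and minimal bounding sphere\<close>

definition subdiff_data ::
    "'a::real_normed_vector set \<Rightarrow> ('a \<Rightarrow> real) \<Rightarrow> 'a \<Rightarrow> 'a set \<Rightarrow> (real \<Rightarrow> real) \<Rightarrow> bool" where
  "subdiff_data \<Omega> f x K \<omega> \<longleftrightarrow>
     bounded K \<and> open K \<and> convex K \<and> x \<in> K \<and> closure K \<subseteq> \<Omega> \<and> semiconvex_on K \<omega> f"

definition subgradient_wrt ::
    "('a::real_inner \<Rightarrow> real) \<Rightarrow> 'a \<Rightarrow> 'a set \<Rightarrow> (real \<Rightarrow> real) \<Rightarrow> 'a \<Rightarrow> bool" where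
  "subgradient_wrt f x K \<omega> p \<longleftrightarrow>
     (\<forall>y. closed_segment x y \<subseteq> K \<longrightarrow>
        f y - f x - p \<bullet> (y - x) \<ge> - norm (y - x) * \<omega> (norm (y - x)))"

text \<open>The choice of \<open>K\<close> and \<open>\<omega>\<close> does not matter, see \<open>frechet_subdiff_eq\<close>.\<close>

definition frechet_subdiff :: "'a::real_inner set \<Rightarrow> ('a \<Rightarrow> real) \<Rightarrow> 'a \<Rightarrow> 'a set" where
  "frechet_subdiff \<Omega> f x = {p. \<exists>K \<omega>. subdiff_data \<Omega> f x K \<omega> \<and> subgradient_wrt f x K \<omega> p}"

lemma subgradient_wrt_indep:
  fixes f :: "'a::real_inner \<Rightarrow> real"
  assumes A: "subdiff_data \<Omega> f x K \<omega>" and B: "subdiff_data \<Omega> f x K' \<omega>'"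
    and p: "subgradient_wrt f x K \<omega> p"
  shows "subgradient_wrt f x K' \<omega>' p"
  unfolding subgradient_wrt_def
proof (intro allI impI)
  fix y assume seg: "closed_segment x y \<subseteq> K'"
  show "f y - f x - p \<bullet> (y - x) \<ge> - norm (y - x) * \<omega>' (norm (y - x))"
  proof (cases "y = x")
    case False
    define d where "d = norm (y - x)"
    have d: "0 < d" using False by (simp add: d_def)
    have sc: "semiconvex_on K' \<omega>' f" and xK: "open K" "convex K" "x \<in> K"
      and lim0: "(\<omega> \<longlongrightarrow> 0) (at_right 0)"
      using A B by (auto simp: subdiff_data_def semiconvex_on_def is_modulus_def)
    have xy: "x \<in> K'" "y \<in> K'" using seg by auto
    obtain e where e: "0 < e" "ball x e \<subseteq> K"
      using xK openE by blast
    have ev: "\<forall>\<^sub>F s in at_right (0::real). - d * \<omega> (s * d) - (1 - s) * d * \<omega>' d \<le> f y - f x - p \<bullet> (y - x)"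
    proof (rule eventually_mono)
      show "\<forall>\<^sub>F s in at_right 0. s \<in> {0<..<min 1 (e / d)}"
        using d e by (intro eventually_at_right_real) auto
    next
      fix s assume "s \<in> {0<..<min 1 (e / d)}"
      then have s: "0 < s" "s < 1" "s * d < e"
        using d e(1) by (auto simp: pos_less_divide_eq)
      have dxy: "norm (x - y) = d" by (simp add: d_def norm_minus_commute)
      define z where "z = x + s *\<^sub>R (y - x)"
      have nz: "norm (z - x) = s * d" using s by (simp add: z_def d_def)
      have "z \<in> ball x e" using nz s by (simp add: dist_norm norm_minus_commute)
      then have "closed_segment x z \<subseteq> K"
        using e xK by (intro closed_segment_subset) auto
      then have 1: "f z - f x - p \<bullet> (z - x) \<ge> - (s * d) * \<omega> (s * d)"
        using p nz unfolding subgradient_wrt_def by metis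
      have zx: "p \<bullet> (z - x) = s * (p \<bullet> (y - x))" by (simp add: z_def)
      have "s * f y + (1 - s) * f x - f (s *\<^sub>R y + (1 - s) *\<^sub>R x) \<ge> - s * (1 - s) * d * \<omega>' d"
        using sc xy s unfolding semiconvex_on_def d_def by auto
      moreover have "s *\<^sub>R y + (1 - s) *\<^sub>R x = z" by (simp add: z_def algebra_simps)
      ultimately have 2: "s * f y + (1 - s) * f x - f z \<ge> - s * (1 - s) * d * \<omega>' d" by simp
      have "s * (- d * \<omega> (s * d) - (1 - s) * d * \<omega>' d) \<le> s * (f y - f x - p \<bullet> (y - x))"
        using 1 2 zx by (simp add: algebra_simps)
      then show "- d * \<omega> (s * d) - (1 - s) * d * \<omega>' d \<le> f y - f x - p \<bullet> (y - x)"
        using s by simp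
    qed
    have fl: "filterlim (\<lambda>s. s * d) (at_right 0) (at_right (0::real))"
    proof (rule tendsto_imp_filterlim_at_right)
      have "((\<lambda>s. s * d) \<longlongrightarrow> 0 * d) (at_right (0::real))" by (intro tendsto_intros)
      then show "((\<lambda>s. s * d) \<longlongrightarrow> 0) (at_right (0::real))" by simp
      show "\<forall>\<^sub>F s in at_right (0::real). 0 < s * d"
        using eventually_at_right_less[of 0] d by (auto elim: eventually_mono)
    qed
    have w: "((\<lambda>s. \<omega> (s * d)) \<longlongrightarrow> 0) (at_right (0::real))"
      using filterlim_compose[OF lim0 fl] .
    have "((\<lambda>s. - d * \<omega> (s * d) - (1 - s) * d * \<omega>' d) \<longlongrightarrow> - d * 0 - (1 - 0) * d * \<omega>' d) (at_right (0::real))"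
      by (intro tendsto_intros w)
    then have "- d * 0 - (1 - 0) * d * \<omega>' d \<le> f y - f x - p \<bullet> (y - x)"
      using ev by (rule tendsto_upperbound) simp
    then show ?thesis by (simp add: d_def)
  qed simp
qed

lemma frechet_subdiff_eq:
  assumes "subdiff_data \<Omega> f x K \<omega>"
  shows "frechet_subdiff \<Omega> f x = {p. subgradient_wrt f x K \<omega> p}"
  using assms subgradient_wrt_indep unfolding frechet_subdiff_def by blast

definition min_bounding_ball :: "'a::metric_space set \<Rightarrow> 'a \<Rightarrow> real \<Rightarrow> bool" where
  "min_bounding_ball K c r \<longleftrightarrow> K \<subseteq> cball c r \<and> (\<forall>c' r'. K \<subseteq> cball c' r' \<longrightarrow> r \<le> r')"

definition min_bounding_radius :: "'a::metric_space set \<Rightarrow> real" where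
  "min_bounding_radius K = (THE r. \<exists>c. min_bounding_ball K c r)"

definition min_bounding_centre :: "'a::metric_space set \<Rightarrow> 'a" where
  "min_bounding_centre K = (THE c. \<exists>r. min_bounding_ball K c r)"


section \<open>Gradient\<close>

definition gradient :: "('a::real_inner \<Rightarrow> real) \<Rightarrow> 'a \<Rightarrow> 'a" where
  "gradient F x = (THE D. GDERIV F x :> D)"

end

theory Submission
  imports Defs
begin

text \<open>
  Write \<open>\<phi> h = F (x0 + h) - F x0\<close>, let \<open>E\<close> be the convex envelope of \<open>\<mu> \<bar>\<cdot>\<bar>\<^sup>2 - \<phi>\<close>, so that the valley
  transform at \<open>x0\<close> is \<open>- E 0\<close>, and let \<open>P\<close> be the subdifferential, with minimal bounding ball of centre
  \<open>c\<close> and radius \<open>r\<close>. Semiconvexity gives \<open>\<phi> h = (max p\<in>P. p \<bullet> h) + o(\<bar>h\<bar>)\<close>, because the directional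
  derivative is sublinear and is approached uniformly in the direction. Since \<open>\<phi> h \<le> c \<bullet> h + (r + \<epsilon>) \<bar>h\<bar>\<close>
  near \<open>0\<close>, the affine function \<open>- (r + \<epsilon>)\<^sup>2 / (4 \<mu>) - c \<bullet> h\<close> is a minorant near \<open>0\<close>, hence everywhere for
  large \<open>\<mu>\<close>; so \<open>- 4 \<mu> E 0 \<le> (r + \<epsilon>)\<^sup>2\<close>. Conversely, if \<open>q\<close> is a subgradient of \<open>E\<close> at \<open>0\<close>, testing
  it at \<open>h = (p + q) / (2 \<mu>)\<close> gives \<open>\<bar>p + q\<bar>\<^sup>2 \<le> - 4 \<mu> E 0 + \<epsilon>\<close> for all \<open>p \<in> P\<close>, so that \<open>P\<close> lies in a ball
  around \<open>- q\<close> whose squared radius is about \<open>- 4 \<mu> E 0\<close>. Minimality of \<open>r\<close> gives the limit of the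
  valley transform, and the parallelogram law forces \<open>- q\<close> to converge to \<open>c\<close>. For a linear modulus \<open>E\<close> is
  differentiable at \<open>0\<close>, and the gradient of the upper transform is \<open>- q\<close>.
\<close>

section \<open>Convex functions and their envelopes\<close>

text \<open>Separate the strict epigraph from the point (x, f x). The normal cannot be horizontal
  because \<open>f\<close> is finite on the whole space, so \<open>x + c\<close> may be tested;
  dividing by its negative vertical component \<open>s\<close> gives the slope.\<close>

lemma convex_on_subgradient:
  fixes f :: "'a::euclidean_space \<Rightarrow> real"
  assumes f: "convex_on UNIV f"
  obtains q where "\<And>y. f x + q \<bullet> (y - x) \<le> f y"
proof -
  define S where "S = {z :: 'a \<times> real. f (fst z) < snd z}"
  have "convex S"
    unfolding convex_def
  proof (intro ballI allI impI)
    fix z w :: "'a \<times> real" and u v :: real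
    assume z: "z \<in> S" and w: "w \<in> S" and uv: "0 \<le> u" "0 \<le> v" "u + v = 1"
    have "f (u *\<^sub>R fst z + v *\<^sub>R fst w) \<le> u * f (fst z) + v * f (fst w)"
      using f uv unfolding convex_on_def by auto
    also have "\<dots> < u * snd z + v * snd w"
    proof (cases "u = 0")
      case True
      then show ?thesis using w uv by (simp add: S_def)
    next
      case False
      then have "u * f (fst z) < u * snd z" "v * f (fst w) \<le> v * snd w"
        using z w uv by (simp_all add: S_def mult_left_mono)
      then show ?thesis by simp
    qed
    finally show "u *\<^sub>R z + v *\<^sub>R w \<in> S" by (simp add: S_def)
  qed
  moreover have "(x, f x + 1) \<in> S" by (simp add: S_def)
  moreover have "S \<inter> {(x, f x)} = {}" by (simp add: S_def)
  ultimately obtain a b where a: "a \<noteq> 0" "\<And>z. z \<in> S \<Longrightarrow> a \<bullet> z \<le> b" "a \<bullet> (x, f x) \<ge> b"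
    using separating_hyperplane_sets[of S "{(x, f x)}"] by fast
  define c s where "c = fst a" and "s = snd a"
  have sep: "c \<bullet> y + s * t \<le> c \<bullet> x + s * f x" if "f y < t" for y t
    using a(2)[of "(y, t)"] a(3) that by (simp add: S_def c_def s_def inner_prod_def)
  have "s \<le> 0" using sep[of x "f x + 1"] by (simp add: algebra_simps)
  moreover have "s \<noteq> 0"
  proof
    assume s0: "s = 0"
    have "c \<bullet> (x + c) \<le> c \<bullet> x" using sep[of "x + c" "f (x + c) + 1"] s0 by simp
    then have "c = 0" by (simp add: inner_add_right) (metis inner_eq_zero_iff inner_ge_zero order_antisym)
    then show False using s0 a(1) by (simp add: c_def s_def prod_eq_iff)
  qed
  ultimately have s: "s < 0" by simp
  show thesis
  proof (rule that[of "- c /\<^sub>R s"])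
    fix y
    show "f x + (- c /\<^sub>R s) \<bullet> (y - x) \<le> f y"
    proof (rule field_le_epsilon)
      fix e :: real assume "0 < e"
      then have "c \<bullet> y + s * (f y + e) \<le> c \<bullet> x + s * f x" by (intro sep) simp
      moreover have "s * ((- c /\<^sub>R s) \<bullet> (y - x)) = c \<bullet> x - c \<bullet> y"
        using s by (simp add: inner_diff_right right_diff_distrib flip: mult.assoc)
      ultimately have "s * (f y + e) \<le> s * (f x + (- c /\<^sub>R s) \<bullet> (y - x))"
        unfolding distrib_left by linarith
      then show "f x + (- c /\<^sub>R s) \<bullet> (y - x) \<le> f y + e" using s by simp
    qed
  qed
qed

lemma convex_on_affine_precomp:
  fixes f :: "'a::real_vector \<Rightarrow> real"
  assumes f: "convex_on UNIV f"
  shows "convex_on UNIV (\<lambda>x. f (a + c *\<^sub>R x))"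
  unfolding convex_on_def
proof (intro conjI ballI allI impI)
  fix x y :: 'a and u v :: real
  assume uv: "0 \<le> u" "0 \<le> v" "u + v = 1"
  then have "a + c *\<^sub>R (u *\<^sub>R x + v *\<^sub>R y) = u *\<^sub>R (a + c *\<^sub>R x) + v *\<^sub>R (a + c *\<^sub>R y)"
    by (simp add: algebra_simps flip: scaleR_add_left)
  then show "f (a + c *\<^sub>R (u *\<^sub>R x + v *\<^sub>R y)) \<le> u * f (a + c *\<^sub>R x) + v * f (a + c *\<^sub>R y)"
    using f uv unfolding convex_on_def by simp
qed simp

lemma convex_on_affine_fun: "convex_on UNIV (\<lambda>x::'a::real_inner. b + q \<bullet> x)"
  unfolding convex_on_def
proof (intro conjI ballI allI impI)
  fix x y :: 'a and u v :: real
  assume "u + v = 1"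
  then have "u * b + v * b = b" by (simp flip: distrib_right)
  then show "b + q \<bullet> (u *\<^sub>R x + v *\<^sub>R y) \<le> u * (b + q \<bullet> x) + v * (b + q \<bullet> y)"
    by (simp add: algebra_simps)
qed simp

text \<open>Translating and adding an affine function is an invertible operation on convex
  minorants, so each inequality follows by transporting an envelope. The minorant \<open>h0\<close>
  makes both envelopes meaningful.\<close>

lemma convex_envelope_affine_change:
  fixes g :: "'a::real_inner \<Rightarrow> real"
  assumes h0: "convex_on UNIV h0" "\<And>y. h0 y \<le> g y"
  shows "convex_envelope (\<lambda>y. g (y - a) + b + q \<bullet> y) x = convex_envelope g (x - a) + b + q \<bullet> x"
proof -
  let ?g = "\<lambda>y. g (y - a) + b + q \<bullet> y"
  have shift: "convex_on UNIV (\<lambda>y. h (y - a) + b + q \<bullet> y)" if "convex_on UNIV h" for h :: "'a \<Rightarrow> real"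
    using convex_on_add[OF convex_on_affine_precomp[OF that, of "- a" 1] convex_on_affine_fun[of b q]]
    by (simp add: algebra_simps)
  have unshift: "convex_on UNIV (\<lambda>y. h (y + a) - b - q \<bullet> (y + a))" if "convex_on UNIV h" for h :: "'a \<Rightarrow> real"
    using convex_on_add[OF convex_on_affine_precomp[OF that, of a 1] convex_on_affine_fun[of "- b - q \<bullet> a" "- q"]]
    by (simp add: algebra_simps)
  note E = convex_envelope_greatest[OF h0]
  have h0': "convex_on UNIV (\<lambda>y. h0 (y - a) + b + q \<bullet> y)" "\<And>y. h0 (y - a) + b + q \<bullet> y \<le> ?g y"
    using shift[OF h0(1)] h0(2) by simp_all
  note E' = convex_envelope_greatest[OF h0']
  show ?thesis
  proof (rule antisym)
    have "convex_envelope ?g ((x - a) + a) - b - q \<bullet> ((x - a) + a) \<le> convex_envelope g (x - a)"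
    proof (rule E(3)[of "\<lambda>y. convex_envelope ?g (y + a) - b - q \<bullet> (y + a)"])
      show "convex_on UNIV (\<lambda>y. convex_envelope ?g (y + a) - b - q \<bullet> (y + a))"
        by (rule unshift[OF E'(1)])
      show "convex_envelope ?g (y + a) - b - q \<bullet> (y + a) \<le> g y" for y
        using E'(2)[of "y + a"] by simp
    qed
    then show "convex_envelope ?g x \<le> convex_envelope g (x - a) + b + q \<bullet> x" by simp
    show "convex_envelope g (x - a) + b + q \<bullet> x \<le> convex_envelope ?g x"
      by (rule E'(3)[of "\<lambda>y. convex_envelope g (y - a) + b + q \<bullet> y"])
        (use shift[OF E(1)] E(2) in auto)
  qed
qed

section \<open>The transform at a point\<close>

locale lipschitz_germ =
  fixes \<phi> :: "'a::euclidean_space \<Rightarrow> real" and L :: real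
  assumes lip: "L-lipschitz_on UNIV \<phi>" and zero: "\<phi> 0 = 0"
begin

definition env :: "real \<Rightarrow> 'a \<Rightarrow> real" where
  "env \<mu> = convex_envelope (\<lambda>h. \<mu> * (norm h)\<^sup>2 - \<phi> h)"

lemma L_nonneg: "0 \<le> L"
  using lip by (rule lipschitz_on_nonneg)

lemma abs_le: "\<bar>\<phi> h\<bar> \<le> L * norm h"
  using lipschitz_onD[OF lip, of h 0] by (simp add: zero dist_real_def)

section \<open>A priori bounds on the envelope\<close>

text \<open>The left side is the minimum of \<mu> t^2 - L t over real t. As a constant it is also
  the convex minorant that makes \<open>env\<close> well defined.\<close>

lemma quadratic_minorant:
  assumes "0 < \<mu>"
  shows "- L\<^sup>2 / (4 * \<mu>) \<le> \<mu> * (norm h)\<^sup>2 - \<phi> h"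
proof -
  have "0 \<le> (2 * \<mu> * norm h - L)\<^sup>2" by simp
  then have "- L\<^sup>2 \<le> 4 * \<mu> * (\<mu> * (norm h)\<^sup>2 - L * norm h)"
    by (simp add: power2_eq_square algebra_simps)
  then have "- L\<^sup>2 / (4 * \<mu>) \<le> \<mu> * (norm h)\<^sup>2 - L * norm h"
    using assms by (subst pos_divide_le_eq) (simp_all add: mult.commute)
  then show ?thesis using abs_le[of h] by simp
qed

lemma env:
  assumes "0 < \<mu>"
  shows convex_env: "convex_on UNIV (env \<mu>)"
    and env_le: "env \<mu> h \<le> \<mu> * (norm h)\<^sup>2 - \<phi> h"
    and env_greatest: "\<And>k. convex_on UNIV k \<Longrightarrow> (\<And>h. k h \<le> \<mu> * (norm h)\<^sup>2 - \<phi> h) \<Longrightarrow> k h \<le> env \<mu> h"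
  using convex_envelope_greatest[of "\<lambda>_. - L\<^sup>2 / (4 * \<mu>)" "\<lambda>h. \<mu> * (norm h)\<^sup>2 - \<phi> h"]
    quadratic_minorant[OF assms]
  by (auto simp: env_def convex_on_const)

lemma env_0_bounds:
  assumes "0 < \<mu>"
  shows "- L\<^sup>2 / (4 * \<mu>) \<le> env \<mu> 0" "env \<mu> 0 \<le> 0"
  using env_greatest[OF assms, of "\<lambda>_. - L\<^sup>2 / (4 * \<mu>)" 0] quadratic_minorant[OF assms]
    env_le[OF assms, of 0]
  by (auto simp: convex_on_const zero)

text \<open>The bound does not depend on \<mu>; this later forces the test points of size O(1/\<mu>)
  into any given neighbourhood of 0.\<close>

lemma env_subgradient_bound:
  assumes \<mu>: "0 < \<mu>" and q: "\<And>h. env \<mu> 0 + q \<bullet> h \<le> env \<mu> h"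
  shows "norm q \<le> 1 + L + L\<^sup>2 / 4"
proof (cases "q = 0")
  case False
  \<comment> \<open>With a step of length 1/\<mu> every term of the comparison is of order 1/\<mu>,
    so multiplying by \<mu> removes it.\<close>
  define h where "h = (1 / (\<mu> * norm q)) *\<^sub>R q"
  have h: "norm h = 1 / \<mu>" "q \<bullet> h = norm q / \<mu>"
    using False \<mu> by (simp_all add: h_def dot_square_norm power2_eq_square)
  have "- L\<^sup>2 / (4 * \<mu>) + norm q / \<mu> \<le> \<mu> * (1 / \<mu>)\<^sup>2 + L * (1 / \<mu>)"
    using env_0_bounds(1)[OF \<mu>] q[of h] env_le[OF \<mu>, of h] abs_le[of h] h by simp
  then have "\<mu> * (- L\<^sup>2 / (4 * \<mu>) + norm q / \<mu>) \<le> \<mu> * (\<mu> * (1 / \<mu>)\<^sup>2 + L * (1 / \<mu>))"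
    using \<mu> by (intro mult_left_mono) auto
  moreover have "\<mu> * (- L\<^sup>2 / (4 * \<mu>) + norm q / \<mu>) = norm q - L\<^sup>2 / 4"
    using \<mu> by (simp add: right_diff_distrib)
  moreover have "\<mu> * (\<mu> * (1 / \<mu>)\<^sup>2 + L * (1 / \<mu>)) = 1 + L"
    using \<mu> by (simp add: field_simps power2_eq_square)
  ultimately show ?thesis by simp
qed (use L_nonneg in simp)

section \<open>Locality and differentiability of the envelope at 0\<close>

text \<open>An affine function below \<open>\<mu> \<bar>\<cdot>\<bar>\<^sup>2 - \<phi>\<close> near \<open>0\<close> only is either below it everywhere, since its
  slope is at most \<open>\<mu> \<delta> - L\<close>, or so negative at \<open>0\<close> that the general lower bound on the envelope
  applies.\<close>

lemma affine_le_env_local: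
  assumes \<mu>: "0 < \<mu>" and \<delta>: "0 < \<delta>" and large: "2 * L + L\<^sup>2 / (2 * \<mu> * \<delta>) \<le> \<mu> * \<delta> / 2"
    and loc: "\<And>h. norm h < \<delta> \<Longrightarrow> b + q \<bullet> h \<le> \<mu> * (norm h)\<^sup>2 - \<phi> h"
  shows "b \<le> env \<mu> 0"
proof (cases "b \<le> - L\<^sup>2 / (4 * \<mu>)")
  case True
  then show ?thesis using env_0_bounds(1)[OF \<mu>] by simp
next
  case False
  have b0: "b \<le> 0" using loc[of 0] \<delta> by (simp add: zero)
  have q: "norm q \<le> \<mu> * \<delta> / 2 + L + L\<^sup>2 / (2 * \<mu> * \<delta>)"
  proof (cases "q = 0")
    case True
    then show ?thesis using L_nonneg \<mu> \<delta> by simp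
  next
    case q0: False
    \<comment> \<open>A point halfway to the boundary of the region where \<open>loc\<close> holds;
      since b exceeds -L^2/(4\<mu>), the inequality there bounds the slope.\<close>
    define h where "h = (\<delta> / (2 * norm q)) *\<^sub>R q"
    have h: "norm h = \<delta> / 2" "q \<bullet> h = norm q * (\<delta> / 2)"
      using q0 \<delta> by (simp_all add: h_def dot_square_norm power2_eq_square)
    have "norm q * (\<delta> / 2) \<le> \<mu> * (\<delta> / 2)\<^sup>2 + L * (\<delta> / 2) + L\<^sup>2 / (4 * \<mu>)"
      using loc[of h] abs_le[of h] h False \<delta> by simp
    then have "(norm q * (\<delta> / 2)) * (2 / \<delta>) \<le> (\<mu> * (\<delta> / 2)\<^sup>2 + L * (\<delta> / 2) + L\<^sup>2 / (4 * \<mu>)) * (2 / \<delta>)"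
      using \<delta> by (intro mult_right_mono) auto
    then show ?thesis using \<mu> \<delta> by (simp add: field_simps power2_eq_square)
  qed
  have "b + q \<bullet> h \<le> \<mu> * (norm h)\<^sup>2 - \<phi> h" for h
  proof (cases "norm h < \<delta>")
    case far: False
    \<comment> \<open>\<open>large\<close> is exactly the condition under which the slope bound
      \<open>q\<close> becomes this one.\<close>
    have "norm q \<le> \<mu> * \<delta> - L" using q large by linarith
    also have "\<dots> \<le> \<mu> * norm h - L" using far \<mu> by simp
    finally have "norm q * norm h \<le> (\<mu> * norm h - L) * norm h"
      by (rule mult_right_mono) simp
    then have "q \<bullet> h \<le> \<mu> * (norm h)\<^sup>2 - L * norm h"
      using norm_cauchy_schwarz[of q h] by (simp add: power2_eq_square algebra_simps)
    then show ?thesis using b0 abs_le[of h] by simp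
  qed (rule loc)
  then show ?thesis
    using env_greatest[OF \<mu> convex_on_affine_fun[of b q], of 0] by simp
qed

lemma eventually_local:
  assumes "0 < \<delta>"
  shows "\<forall>\<^sub>F \<mu> in at_top. 0 < \<mu> \<and> 2 * L + L\<^sup>2 / (2 * \<mu> * \<delta>) \<le> \<mu> * \<delta> / 2"
proof -
  have "\<forall>\<^sub>F \<mu> in at_top. max 1 ((4 * L + L\<^sup>2 / \<delta>) / \<delta>) \<le> (\<mu>::real)" by (rule eventually_ge_at_top)
  then show ?thesis
  proof (rule eventually_mono)
    \<comment> \<open>The bound 1 \<le> \<mu> replaces the fraction by L^2/(2\<delta>); the other
      entry of the maximum then solves the remaining linear inequality.\<close>
    fix \<mu> :: real assume m: "max 1 ((4 * L + L\<^sup>2 / \<delta>) / \<delta>) \<le> \<mu>"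
    then have "L\<^sup>2 / (2 * \<mu> * \<delta>) \<le> L\<^sup>2 / (2 * 1 * \<delta>)"
      using assms m by (intro divide_left_mono mult_right_mono mult_left_mono mult_pos_pos) auto
    moreover have "L\<^sup>2 / (2 * 1 * \<delta>) = (L\<^sup>2 / \<delta>) / 2" by simp
    moreover have "4 * L + L\<^sup>2 / \<delta> \<le> \<mu> * \<delta>"
      using m assms by (simp add: pos_divide_le_eq)
    moreover have "1 \<le> \<mu>" using m by simp
    ultimately show "0 < \<mu> \<and> 2 * L + L\<^sup>2 / (2 * \<mu> * \<delta>) \<le> \<mu> * \<delta> / 2"
      by linarith
  qed
qed

text \<open>With \<open>\<mu> \<bar>\<cdot>\<bar>\<^sup>2 - \<phi>\<close> semiconcave near \<open>0\<close>, the symmetric average of the envelope over \<open>x \<plusminus> h\<close>,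
  lowered by \<open>(\<mu> + \<kappa>) \<bar>h\<bar>\<^sup>2\<close>, is convex in \<open>x\<close> and stays below that function near \<open>0\<close>. By locality it
  does not exceed the envelope at \<open>0\<close>, so the envelope is semiconcave there as well as convex.\<close>

lemma env_differentiable:
  assumes m: "0 < \<delta>" and sc: "\<And>x h. norm x < \<delta> \<Longrightarrow> norm h < \<delta> \<Longrightarrow>
      \<phi> (x + h) + \<phi> (x - h) - 2 * \<phi> x \<ge> - 2 * \<kappa> * (norm h)\<^sup>2"
  shows "\<forall>\<^sub>F \<mu> in at_top. \<exists>q. (\<forall>h. env \<mu> 0 + q \<bullet> h \<le> env \<mu> h) \<and> GDERIV (env \<mu>) 0 :> q"
  using eventually_local[OF m] eventually_gt_at_top[of "- \<kappa>"]
proof eventually_elim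
  case (elim \<mu>)
  then have \<mu>: "0 < \<mu>" "0 < \<mu> + \<kappa>" by auto
  obtain q where "\<And>h. env \<mu> 0 + q \<bullet> (h - 0) \<le> env \<mu> h"
    using convex_on_subgradient[OF convex_env[OF \<mu>(1)]] by blast
  then have q: "\<And>h. env \<mu> 0 + q \<bullet> h \<le> env \<mu> h" by simp
  have second: "env \<mu> h + env \<mu> (- h) \<le> 2 * env \<mu> 0 + 2 * (\<mu> + \<kappa>) * (norm h)\<^sup>2" if h: "norm h < \<delta>" for h
  proof -
    define k where "k x = (1/2) * env \<mu> (h + 1 *\<^sub>R x) + (1/2) * env \<mu> (- h + 1 *\<^sub>R x) + - ((\<mu> + \<kappa>) * (norm h)\<^sup>2)" for x
    have half: "convex_on UNIV (\<lambda>x. (1/2) * env \<mu> (a + 1 *\<^sub>R x))" for a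
      by (rule convex_on_cmul[OF _ convex_on_affine_precomp[OF convex_env[OF \<mu>(1)]]]) simp
    have "convex_on UNIV (\<lambda>_::'a. - ((\<mu> + \<kappa>) * (norm h)\<^sup>2))"
      by (simp add: convex_on_const)
    then have "convex_on UNIV k"
      unfolding k_def by (rule convex_on_add[OF convex_on_add[OF half half]])
    \<comment> \<open>\<open>k\<close> lies below the target only near 0, so locality is applied to
      its affine support at 0.\<close>
    from convex_on_subgradient[OF this, of 0]
    obtain w where w: "\<And>x. k 0 + w \<bullet> x \<le> k x" by auto
    have "k 0 \<le> env \<mu> 0"
    proof (rule affine_le_env_local[OF \<mu>(1) m _, of _ w])
      fix x :: 'a assume x: "norm x < \<delta>"
      have "k x \<le> (1/2) * (\<mu> * (norm (h + x))\<^sup>2 - \<phi> (h + x)) + (1/2) * (\<mu> * (norm (- h + x))\<^sup>2 - \<phi> (- h + x))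
          + - ((\<mu> + \<kappa>) * (norm h)\<^sup>2)"
        unfolding k_def scaleR_one by (intro add_mono mult_left_mono env_le \<mu>) auto
      \<comment> \<open>The parallelogram law produces \<mu> |h|^2, which cancels against the
        lowering and leaves -\<kappa> |h|^2 to absorb the semiconvexity error.\<close>
      also have "\<dots> = \<mu> * (norm x)\<^sup>2 - (\<phi> (x + h) + \<phi> (x - h)) / 2 - \<kappa> * (norm h)\<^sup>2"
        unfolding power2_norm_eq_inner
        by (simp add: inner_add inner_diff inner_commute) (simp add: field_simps)
      also have "\<dots> \<le> \<mu> * (norm x)\<^sup>2 - \<phi> x" using sc[OF x h] by argo
      finally show "k 0 + w \<bullet> x \<le> \<mu> * (norm x)\<^sup>2 - \<phi> x" using w[of x] by simp
    qed (use elim in auto)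
    then show ?thesis by (simp add: k_def field_simps)
  qed
  have "(env \<mu> has_derivative (\<lambda>h. h \<bullet> q)) (at 0)"
    unfolding has_derivative_at_alt
  proof (intro conjI allI impI)
    show "bounded_linear (\<lambda>h. h \<bullet> q)" by (rule bounded_linear_inner_left)
    fix e :: real assume e: "0 < e"
    show "\<exists>d>0. \<forall>y. norm (y - 0) < d \<longrightarrow> norm (env \<mu> y - env \<mu> 0 - (y - 0) \<bullet> q) \<le> e * norm (y - 0)"
    proof (intro exI[of _ "min \<delta> (e / (2 * (\<mu> + \<kappa>)))"] conjI allI impI)
      show "0 < min \<delta> (e / (2 * (\<mu> + \<kappa>)))" using m e \<mu> by simp
      fix y :: 'a assume "norm (y - 0) < min \<delta> (e / (2 * (\<mu> + \<kappa>)))"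
      then have y: "norm y < \<delta>" "2 * (\<mu> + \<kappa>) * norm y < e"
        using \<mu> by (auto simp: pos_less_divide_eq mult.commute)
      have "2 * (\<mu> + \<kappa>) * (norm y)\<^sup>2 \<le> e * norm y"
        using mult_right_mono[of "2 * (\<mu> + \<kappa>) * norm y" e "norm y"] y by (simp add: power2_eq_square mult.assoc)
      \<comment> \<open>The subgradient inequality at y is the lower estimate; the one at -y,
        inserted into \<open>second\<close>, is the upper estimate.\<close>
      then show "norm (env \<mu> y - env \<mu> 0 - (y - 0) \<bullet> q) \<le> e * norm (y - 0)"
        using second[OF y(1)] q[of y] q[of "- y"] by (simp add: inner_commute)
    qed
  qed
  then show ?case using q by (auto simp: gderiv_def)
qed

end

section \<open>From the germ back to the transform of \<open>F\<close>\<close>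

lemma lipschitz_germ_shift:
  fixes F :: "'a::euclidean_space \<Rightarrow> real"
  assumes "L-lipschitz_on UNIV F"
  shows "lipschitz_germ (\<lambda>h. F (x0 + h) - F x0) L"
proof
  show "L-lipschitz_on UNIV (\<lambda>h. F (x0 + h) - F x0)"
  proof (rule lipschitz_onI)
    show "dist (F (x0 + x) - F x0) (F (x0 + y) - F x0) \<le> L * dist x y" for x y
      using lipschitz_onD[OF assms, of "x0 + x" "x0 + y"] by (simp add: dist_norm)
  qed (rule lipschitz_on_nonneg[OF assms])
qed simp

text \<open>Expanding |y|^2 around \<open>x0\<close> changes the function under the envelope only by
  a translation and an affine term, which the outer quadratic compensates.\<close>

lemma upper_transform_env:
  fixes F :: "'a::euclidean_space \<Rightarrow> real" and x0 :: 'a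
  assumes F: "L-lipschitz_on UNIV F" and \<mu>: "0 < \<mu>"
  defines "\<phi> \<equiv> \<lambda>h. F (x0 + h) - F x0"
  shows "upper_transform \<mu> F (x0 + h) = \<mu> * (norm h)\<^sup>2 + F x0 - lipschitz_germ.env \<phi> \<mu> h"
proof -
  interpret lipschitz_germ \<phi> L
    unfolding \<phi>_def by (rule lipschitz_germ_shift[OF F])
  let ?g = "\<lambda>h. \<mu> * (norm h)\<^sup>2 - \<phi> h"
  have eq: "\<mu> * (norm y)\<^sup>2 - F y = ?g (y - x0) + (- \<mu> * (norm x0)\<^sup>2 - F x0) + (2 * \<mu>) *\<^sub>R x0 \<bullet> y" for y
    unfolding \<phi>_def power2_norm_eq_inner by (simp add: inner_diff algebra_simps inner_commute)
  have "convex_envelope (\<lambda>y. \<mu> * (norm y)\<^sup>2 - F y) (x0 + h)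
      = env \<mu> h + (- \<mu> * (norm x0)\<^sup>2 - F x0) + (2 * \<mu>) *\<^sub>R x0 \<bullet> (x0 + h)"
    unfolding eq env_def
    by (subst convex_envelope_affine_change[OF convex_env[OF \<mu>] env_le[OF \<mu>]]) simp
  then show ?thesis
    unfolding upper_transform_def power2_norm_eq_inner by (simp add: inner_add algebra_simps inner_commute)
qed

section \<open>Minimal bounding balls\<close>

lemma norm_midpoint_sq:
  fixes a b :: "'a::real_inner"
  shows "(norm ((1/2) *\<^sub>R (a + b)))\<^sup>2 = ((norm a)\<^sup>2 + (norm b)\<^sup>2) / 2 - (norm (a - b))\<^sup>2 / 4"
  unfolding power2_norm_eq_inner
  by (simp add: inner_add inner_diff inner_commute) (simp add: field_simps)

lemma subset_cball_sqrt:
  fixes P :: "'a::real_normed_vector set"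
  assumes ne: "P \<noteq> {}" and near: "\<And>p. p \<in> P \<Longrightarrow> (norm (p + q))\<^sup>2 \<le> s"
  shows "0 \<le> s" "P \<subseteq> cball (- q) (sqrt s)"
proof -
  show "0 \<le> s"
    using ne near by (meson all_not_in_conv order_trans zero_le_power2)
  show "P \<subseteq> cball (- q) (sqrt s)"
  proof
    fix p assume "p \<in> P"
    then have "norm (p + q) \<le> sqrt s" by (intro real_le_rsqrt near)
    moreover have "dist (- q) p = norm (p + q)"
      by (simp add: dist_norm norm_minus_commute[of "- q"])
    ultimately show "p \<in> cball (- q) (sqrt s)" by simp
  qed
qed

lemma min_bounding_ball_radius_nonneg:
  fixes P :: "'a::metric_space set"
  assumes "P \<noteq> {}" "min_bounding_ball P c r"
  shows "0 \<le> r"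
proof -
  obtain p where "p \<in> P" using assms(1) by blast
  then have "dist c p \<le> r" using assms(2) by (auto simp: min_bounding_ball_def)
  then show ?thesis using zero_le_dist[of c p] by linarith
qed

text \<open>By the parallelogram law P also lies in the ball of squared radius \<open>s\<close>
  around the midpoint of the two centres, so minimality gives r^2 \<le> s. This yields uniqueness of
  the ball and convergence of nearly optimal centres.\<close>

lemma min_bounding_ball_stable:
  fixes P :: "'a::real_inner set"
  assumes ne: "P \<noteq> {}" and m: "min_bounding_ball P c r" and P: "P \<subseteq> cball c' r'"
  shows "(dist c c')\<^sup>2 \<le> 2 * (r'\<^sup>2 - r\<^sup>2)"
proof -
  note r = min_bounding_ball_radius_nonneg[OF ne m]
  define s where "s = (r\<^sup>2 + r'\<^sup>2) / 2 - (dist c c')\<^sup>2 / 4"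
  have near: "(dist ((1/2) *\<^sub>R (c + c')) p)\<^sup>2 \<le> s" if p: "p \<in> P" for p
  proof -
    have "dist c p \<le> r" "dist c' p \<le> r'"
      using p m P by (auto simp: min_bounding_ball_def)
    then have "(norm (c - p))\<^sup>2 \<le> r\<^sup>2" "(norm (c' - p))\<^sup>2 \<le> r'\<^sup>2"
      by (auto simp: dist_norm power_mono)
    moreover have "(1/2) *\<^sub>R (c + c') - p = (1/2) *\<^sub>R ((c - p) + (c' - p))"
      by (simp add: algebra_simps flip: scaleR_add_left)
    moreover have "(c - p) - (c' - p) = c - c'" by simp
    ultimately show ?thesis
      unfolding s_def dist_norm using norm_midpoint_sq[of "c - p" "c' - p"] by simp
  qed
  then have "0 \<le> s" using ne by (meson all_not_in_conv order_trans zero_le_power2)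
  have "P \<subseteq> cball ((1/2) *\<^sub>R (c + c')) (sqrt s)"
    using near by (auto simp only: mem_cball intro!: subsetI real_le_rsqrt)
  then have "r \<le> sqrt s" using m by (auto simp: min_bounding_ball_def)
  then have "r\<^sup>2 \<le> s" using r \<open>0 \<le> s\<close> by (metis power_mono real_sqrt_pow2)
  then show ?thesis unfolding s_def by argo
qed

lemma min_bounding_ball_unique:
  fixes P :: "'a::real_inner set"
  assumes ne: "P \<noteq> {}" and m: "min_bounding_ball P c r"
  shows "min_bounding_radius P = r" "min_bounding_centre P = c"
proof -
  have "r' = r \<and> c' = c" if m': "min_bounding_ball P c' r'" for c' r'
  proof -
    have "r' = r" using m m' by (auto simp: min_bounding_ball_def intro: antisym)
    moreover have "P \<subseteq> cball c' r'" using m' by (simp add: min_bounding_ball_def)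
    ultimately show ?thesis using min_bounding_ball_stable[OF ne m, of c' r'] by simp
  qed
  then show "min_bounding_radius P = r" "min_bounding_centre P = c"
    unfolding min_bounding_radius_def min_bounding_centre_def
    using m by (blast intro!: the_equality)+
qed

text \<open>Let r be the infimum of the admissible radii. The centres admissible for radius r +
  1/(n+1) form nested non-empty compact sets, and a common point is a centre for r.\<close>

lemma min_bounding_ball_exists:
  fixes P :: "'a::euclidean_space set"
  assumes P: "compact P" "P \<noteq> {}"
  obtains c r where "min_bounding_ball P c r"
proof -
  define S where "S = {r. \<exists>c. P \<subseteq> cball c r}"
  define r where "r = Inf S"
  obtain p where p: "p \<in> P" using P(2) by blast
  have ne: "S \<noteq> {}"
    using compact_imp_bounded[OF P(1)] by (auto simp: S_def bounded_subset_cball)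
  have bdd: "bdd_below S"
  proof (rule bdd_belowI[of _ 0])
    fix t assume "t \<in> S"
    then obtain c where "dist c p \<le> t" using p by (auto simp: S_def)
    then show "0 \<le> t" using zero_le_dist[of c p] by linarith
  qed
  define A where "A n = (\<Inter>x\<in>P. cball x (r + 1 / real (Suc n)))" for n
  have "\<Inter>(range A) \<noteq> {}"
  proof (rule compact_nest)
    show "compact (A n)" for n
      unfolding A_def using p by (intro compact_Inter) auto
    show "A n \<noteq> {}" for n
    proof -
      obtain t where t: "t \<in> S" "t < r + 1 / real (Suc n)"
        using cInf_lessD[OF ne, of "r + 1 / real (Suc n)"] by (auto simp: r_def)
      then obtain c where "P \<subseteq> cball c t" by (auto simp: S_def)
      then have "c \<in> A n" using t(2) by (force simp: A_def dist_commute)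
      then show ?thesis by blast
    qed
    show "A n \<subseteq> A m" if "m \<le> n" for m n
    proof -
      have "1 / real (Suc n) \<le> 1 / real (Suc m)" using that by (simp add: frac_le)
      then show ?thesis unfolding A_def by (intro INT_anti_mono subset_refl) (simp add: subset_cball)
    qed
  qed
  then obtain c where c: "\<And>n. c \<in> A n" by blast
  have "dist c x \<le> r" if "x \<in> P" for x
  proof (rule field_le_epsilon)
    fix e :: real assume "0 < e"
    then obtain n where "1 / real (Suc n) < e" using nat_approx_posE by blast
    moreover have "dist c x \<le> r + 1 / real (Suc n)"
      using c[of n] that by (auto simp: A_def dist_commute)
    ultimately show "dist c x \<le> r + e" by simp
  qed
  then have "P \<subseteq> cball c r" by auto
  moreover have "r \<le> r'" if "P \<subseteq> cball c' r'" for c' r'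
    unfolding r_def using that by (intro cInf_lower bdd) (auto simp: S_def)
  ultimately show thesis using that unfolding min_bounding_ball_def by blast
qed

text \<open>Projecting c onto P moves it closer to every point of P: the obtuse angle at the
  projection lowers each squared distance by at least the squared displacement, so stability forces
  the displacement to vanish.\<close>

lemma min_bounding_ball_centre_mem:
  fixes P :: "'a::euclidean_space set"
  assumes P: "convex P" "closed P" "P \<noteq> {}" and m: "min_bounding_ball P c r"
  shows "c \<in> P"
proof -
  define c' where "c' = closest_point P c"
  have c': "c' \<in> P" using P by (simp add: c'_def closest_point_in_set)
  define s where "s = r\<^sup>2 - (dist c c')\<^sup>2"
  have near: "(dist c' p)\<^sup>2 \<le> s" if p: "p \<in> P" for p
  proof -
    have "(c - c') \<bullet> (p - c') \<le> 0"
      unfolding c'_def by (rule closest_point_dot[OF P(1,2) p])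
    then have "(norm (c - c'))\<^sup>2 + (norm (c' - p))\<^sup>2 \<le> (norm (c - p))\<^sup>2"
      unfolding power2_norm_eq_inner by (simp add: algebra_simps inner_commute)
    also have "norm (c - p) \<le> r"
      using m p by (auto simp: min_bounding_ball_def dist_norm)
    then have "(norm (c - p))\<^sup>2 \<le> r\<^sup>2" by (simp add: power_mono)
    finally show ?thesis by (simp add: s_def dist_norm)
  qed
  then have "0 \<le> s" using c' by (meson order_trans zero_le_power2)
  have "P \<subseteq> cball c' (sqrt s)"
    using near by (auto simp only: mem_cball intro!: subsetI real_le_rsqrt)
  then have "(dist c c')\<^sup>2 \<le> 2 * ((sqrt s)\<^sup>2 - r\<^sup>2)"
    by (rule min_bounding_ball_stable[OF P(3) m])
  then have "(dist c c')\<^sup>2 \<le> 0" using \<open>0 \<le> s\<close> by (simp add: s_def)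
  then show ?thesis using c' by simp
qed

section \<open>Asymptotics of the transform\<close>

text \<open>\<open>expansion\<close> says that \<phi> agrees with the support function of
  \<open>P\<close> up to o(|h|). Its upper half controls the depth of the envelope, its lower half
  the subgradients.\<close>

locale subdiff_germ = lipschitz_germ +
  fixes P :: "'a set"
  assumes compact_P: "compact P" and convex_P: "convex P" and P_ne: "P \<noteq> {}"
    and expansion: "\<And>\<epsilon>. 0 < \<epsilon> \<Longrightarrow> \<exists>\<delta>>0. \<forall>h. norm h < \<delta> \<longrightarrow>
      (\<forall>p\<in>P. p \<bullet> h - \<epsilon> * norm h \<le> \<phi> h) \<and> (\<exists>p\<in>P. \<phi> h \<le> p \<bullet> h + \<epsilon> * norm h)"
begin

text \<open>Since P lies in the ball around c, \<phi> h \<le> c \<bullet> h + (r + \<epsilon>) |h|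
  near 0, and \<mu> t^2 - (r + \<epsilon>) t has minimum -(r + \<epsilon>)^2/(4\<mu>).\<close>

lemma env_0_lower:
  assumes m: "min_bounding_ball P c r" and \<epsilon>: "0 < \<epsilon>"
  shows "\<forall>\<^sub>F \<mu> in at_top. - (4 * \<mu> * env \<mu> 0) \<le> (r + \<epsilon>)\<^sup>2"
proof -
  obtain \<delta> where \<delta>: "0 < \<delta>" "\<And>h. norm h < \<delta> \<Longrightarrow> \<exists>p\<in>P. \<phi> h \<le> p \<bullet> h + \<epsilon> * norm h"
    using expansion[OF \<epsilon>] by blast
  show ?thesis
    using eventually_local[OF \<delta>(1)]
  proof (rule eventually_mono)
    fix \<mu> :: real
    assume \<mu>: "0 < \<mu> \<and> 2 * L + L\<^sup>2 / (2 * \<mu> * \<delta>) \<le> \<mu> * \<delta> / 2"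
    have "- (r + \<epsilon>)\<^sup>2 / (4 * \<mu>) \<le> env \<mu> 0"
    proof (rule affine_le_env_local[of \<mu> \<delta> _ "- c"])
      fix h :: 'a assume "norm h < \<delta>"
      then obtain p where p: "p \<in> P" "\<phi> h \<le> p \<bullet> h + \<epsilon> * norm h" using \<delta>(2) by blast
      have "norm (p - c) \<le> r"
        using m p(1) by (auto simp: min_bounding_ball_def dist_norm norm_minus_commute)
      then have "norm (p - c) * norm h \<le> r * norm h" by (rule mult_right_mono) simp
      then have "p \<bullet> h \<le> c \<bullet> h + r * norm h"
        using norm_cauchy_schwarz[of "p - c" h] by (simp add: inner_diff_left)
      then have up: "\<phi> h \<le> c \<bullet> h + (r + \<epsilon>) * norm h" using p(2) by (simp add: algebra_simps)
      have "0 \<le> (2 * \<mu> * norm h - (r + \<epsilon>))\<^sup>2" by simp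
      then have "- (r + \<epsilon>)\<^sup>2 \<le> (\<mu> * (norm h)\<^sup>2 - (r + \<epsilon>) * norm h) * (4 * \<mu>)"
        by (simp add: power2_eq_square algebra_simps)
      then have "- (r + \<epsilon>)\<^sup>2 / (4 * \<mu>) \<le> \<mu> * (norm h)\<^sup>2 - (r + \<epsilon>) * norm h"
        using \<mu> by (subst pos_divide_le_eq) simp_all
      then show "- (r + \<epsilon>)\<^sup>2 / (4 * \<mu>) + (- c) \<bullet> h \<le> \<mu> * (norm h)\<^sup>2 - \<phi> h"
        using up by simp
    qed (use \<mu> \<delta> in auto)
    then have "- (r + \<epsilon>)\<^sup>2 \<le> env \<mu> 0 * (4 * \<mu>)"
      using \<mu> by (subst (asm) pos_divide_le_eq) simp_all
    then show "- (4 * \<mu> * env \<mu> 0) \<le> (r + \<epsilon>)\<^sup>2" by (simp add: algebra_simps)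
  qed
qed

lemma env_subgradient_near:
  assumes \<epsilon>: "0 < \<epsilon>"
  shows "\<forall>\<^sub>F \<mu> in at_top. \<forall>q. (\<forall>h. env \<mu> 0 + q \<bullet> h \<le> env \<mu> h) \<longrightarrow>
    (\<forall>p\<in>P. (norm (p + q))\<^sup>2 \<le> - (4 * \<mu> * env \<mu> 0) + \<epsilon>)"
proof -
  obtain B where B: "0 < B" "\<And>p. p \<in> P \<Longrightarrow> norm p \<le> B"
    using compact_imp_bounded[OF compact_P] by (auto simp: bounded_pos)
  \<comment> \<open>\<open>C\<close> bounds |p + q| for all p in P and all admissible \<mu>;
    \<open>e\<close> is chosen so that 2 e C = \<epsilon>, and \<mu> > C/(2\<delta>) puts the test
    point within \<delta>.\<close>
  define C where "C = B + (1 + L + L\<^sup>2 / 4)"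
  have C: "0 < C" using B(1) L_nonneg by (simp add: C_def add_pos_nonneg)
  define e where "e = \<epsilon> / (2 * C)"
  have e: "0 < e" using \<epsilon> C by (simp add: e_def)
  obtain \<delta> where \<delta>: "0 < \<delta>" "\<And>h p. norm h < \<delta> \<Longrightarrow> p \<in> P \<Longrightarrow> p \<bullet> h - e * norm h \<le> \<phi> h"
    using expansion[OF e] by blast
  have "\<forall>\<^sub>F \<mu>::real in at_top. max 0 (C / (2 * \<delta>)) < \<mu>" by (rule eventually_gt_at_top)
  then show ?thesis
  proof (rule eventually_mono, intro allI impI ballI)
    fix \<mu> :: real and q p :: 'a
    assume \<mu>': "max 0 (C / (2 * \<delta>)) < \<mu>" and q: "\<forall>h. env \<mu> 0 + q \<bullet> h \<le> env \<mu> h" and p: "p \<in> P"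
    then have \<mu>: "0 < \<mu>" "C < 2 * \<mu> * \<delta>" using \<delta>(1) by (auto simp: pos_divide_less_eq algebra_simps)
    define s where "s = norm (p + q)"
    have s: "0 \<le> s" "s \<le> C"
      using norm_triangle_ineq[of p q] B(2)[OF p] env_subgradient_bound[OF \<mu>(1), of q] q
      by (auto simp: s_def C_def)
    \<comment> \<open>the maximiser of \<open>(p + q) \<bullet> h - \<mu> \<bar>h\<bar>\<^sup>2\<close>\<close>
    define h where "h = (1 / (2 * \<mu>)) *\<^sub>R (p + q)"
    have nh: "norm h = s / (2 * \<mu>)" using \<mu> by (simp add: h_def s_def)
    have ph: "p \<bullet> h + q \<bullet> h = s\<^sup>2 / (2 * \<mu>)"
      unfolding h_def s_def power2_norm_eq_inner by (simp add: inner_add add_divide_distrib)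
    have "norm h < \<delta>" unfolding nh using s \<mu> by (simp add: pos_divide_less_eq algebra_simps)
    then have "env \<mu> 0 + q \<bullet> h \<le> \<mu> * (norm h)\<^sup>2 - (p \<bullet> h - e * norm h)"
      using q env_le[OF \<mu>(1), of h] \<delta>(2)[of h p] p by (smt (verit))
    then have "env \<mu> 0 + s\<^sup>2 / (2 * \<mu>) \<le> \<mu> * (s / (2 * \<mu>))\<^sup>2 + e * (s / (2 * \<mu>))"
      using ph nh by simp
    \<comment> \<open>After this scaling the left side has 2 s^2 and the right side s^2 + 2 e s, so
      one s^2 survives.\<close>
    then have "4 * \<mu> * (env \<mu> 0 + s\<^sup>2 / (2 * \<mu>)) \<le> 4 * \<mu> * (\<mu> * (s / (2 * \<mu>))\<^sup>2 + e * (s / (2 * \<mu>)))"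
      using \<mu> by (intro mult_left_mono) auto
    moreover have "4 * \<mu> * (env \<mu> 0 + s\<^sup>2 / (2 * \<mu>)) = 4 * \<mu> * env \<mu> 0 + 2 * s\<^sup>2"
      using \<mu> by (simp add: distrib_left)
    moreover have "4 * \<mu> * (\<mu> * (s / (2 * \<mu>))\<^sup>2 + e * (s / (2 * \<mu>))) = s\<^sup>2 + 2 * e * s"
      using \<mu> by (simp add: field_simps power2_eq_square)
    moreover have "2 * e * s \<le> \<epsilon>"
      using mult_left_mono[OF s(2), of "2 * e"] e C by (simp add: e_def)
    ultimately show "(norm (p + q))\<^sup>2 \<le> - (4 * \<mu> * env \<mu> 0) + \<epsilon>" by (simp add: s_def)
  qed
qed

text \<open>From above this is \<open>env_0_lower\<close>. From below, any subgradient q encloses P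
  in a ball around -q, whose radius is at least r.\<close>

lemma env_0_tendsto:
  assumes m: "min_bounding_ball P c r"
  shows "((\<lambda>\<mu>. - (4 * \<mu> * env \<mu> 0)) \<longlongrightarrow> r\<^sup>2) at_top"
proof (rule order_tendstoI)
  note r = min_bounding_ball_radius_nonneg[OF P_ne m]
  fix a
  {
    assume "a < r\<^sup>2"
    then have "0 < (r\<^sup>2 - a) / 2" by simp
    from env_subgradient_near[OF this] eventually_gt_at_top[of 0]
    show "\<forall>\<^sub>F \<mu> in at_top. a < - (4 * \<mu> * env \<mu> 0)"
    proof eventually_elim
      case (elim \<mu>)
      obtain q where "\<And>h. env \<mu> 0 + q \<bullet> (h - 0) \<le> env \<mu> h"
        using convex_on_subgradient[OF convex_env[OF elim(2)]] by blast
      then have "\<And>p. p \<in> P \<Longrightarrow> (norm (p + q))\<^sup>2 \<le> - (4 * \<mu> * env \<mu> 0) + (r\<^sup>2 - a) / 2"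
        using elim(1) by simp
      note ball = subset_cball_sqrt[OF P_ne this]
      then have "r \<le> sqrt (- (4 * \<mu> * env \<mu> 0) + (r\<^sup>2 - a) / 2)"
        using m ball(2) by (simp add: min_bounding_ball_def)
      then have "r\<^sup>2 \<le> - (4 * \<mu> * env \<mu> 0) + (r\<^sup>2 - a) / 2"
        using r ball(1) by (metis power_mono real_sqrt_pow2)
      then show ?case using \<open>a < r\<^sup>2\<close> by argo
    qed
  next
    assume a: "r\<^sup>2 < a"
    then have "r < sqrt a" using r by (simp add: real_less_rsqrt)
    then have \<epsilon>: "0 < (sqrt a - r) / 2" "r + (sqrt a - r) / 2 < sqrt a" by argo+
    have "0 \<le> a" using a by (meson less_eq_real_def order_trans zero_le_power2)
    have "(r + (sqrt a - r) / 2)\<^sup>2 < (sqrt a)\<^sup>2"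
      using r \<epsilon> by (intro power_strict_mono) auto
    then have less: "(r + (sqrt a - r) / 2)\<^sup>2 < a" using \<open>0 \<le> a\<close> by simp
    show "\<forall>\<^sub>F \<mu> in at_top. - (4 * \<mu> * env \<mu> 0) < a"
      using env_0_lower[OF m \<epsilon>(1)] by (rule eventually_mono) (use less in linarith)
  }
qed

lemma env_subgradient_tendsto:
  assumes m: "min_bounding_ball P c r" and q: "\<forall>\<^sub>F \<mu> in at_top. \<forall>h. env \<mu> 0 + q \<mu> \<bullet> h \<le> env \<mu> h"
  shows "((\<lambda>\<mu>. - q \<mu>) \<longlongrightarrow> c) at_top"
proof (rule tendstoI)
  fix e :: real assume e: "0 < e"
  \<comment> \<open>The slack e^2/4 enters twice, in the ball and in the limit of its radius; the
    factor 2 of the stability estimate then makes e^2.\<close>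
  then have e4: "0 < e\<^sup>2 / 4" "r\<^sup>2 < r\<^sup>2 + e\<^sup>2 / 4" by auto
  from q env_subgradient_near[OF e4(1)] order_tendstoD(2)[OF env_0_tendsto[OF m] e4(2)]
  show "\<forall>\<^sub>F \<mu> in at_top. dist (- q \<mu>) c < e"
  proof eventually_elim
    case (elim \<mu>)
    define s where "s = - (4 * \<mu> * env \<mu> 0) + e\<^sup>2 / 4"
    have "\<And>p. p \<in> P \<Longrightarrow> (norm (p + q \<mu>))\<^sup>2 \<le> s"
      using elim(1,2) by (simp add: s_def)
    note ball = subset_cball_sqrt[OF P_ne this]
    from min_bounding_ball_stable[OF P_ne m ball(2)]
    have "(dist c (- q \<mu>))\<^sup>2 \<le> 2 * (s - r\<^sup>2)" using ball(1) by simp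
    also have "\<dots> < e\<^sup>2" using elim(3) by (simp add: s_def)
    finally show ?case using e by (simp add: dist_commute power_less_imp_less_base)
  qed
qed

end

section \<open>The subdifferential of a semiconvex germ\<close>

locale semiconvex_germ = lipschitz_germ +
  fixes R :: real and \<omega> :: "real \<Rightarrow> real"
  assumes R: "0 < R" and sc: "semiconvex_on (ball 0 R) \<omega> \<phi>"
begin

section \<open>One-sided directional derivatives\<close>

lemma scD:
  assumes "norm x < R" "norm y < R" "0 \<le> s" "s \<le> 1"
  shows "\<phi> (s *\<^sub>R x + (1 - s) *\<^sub>R y) \<le> s * \<phi> x + (1 - s) * \<phi> y + s * (1 - s) * norm (x - y) * \<omega> (norm (x - y))"
proof -
  have "s * \<phi> x + (1 - s) * \<phi> y - \<phi> (s *\<^sub>R x + (1 - s) *\<^sub>R y)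
      \<ge> - s * (1 - s) * norm (x - y) * \<omega> (norm (x - y))"
    using sc assms unfolding semiconvex_on_def by (auto simp: dist_norm)
  then show ?thesis by simp
qed

lemma modulus_nonneg: "0 \<le> t \<Longrightarrow> 0 \<le> \<omega> t"
  and modulus_tendsto: "(\<omega> \<longlongrightarrow> 0) (at_right 0)"
  using sc by (auto simp: semiconvex_on_def is_modulus_def)

lemma modulus_scaled_tendsto: "((\<lambda>t. d * \<omega> (t * d)) \<longlongrightarrow> 0) (at_right 0)" if "0 \<le> d" for d
proof (cases "d = 0")
  case False
  then have d: "0 < d" using that by simp
  have "filterlim (\<lambda>t. t * d) (at_right 0) (at_right (0::real))"
  proof (rule tendsto_imp_filterlim_at_right)
    have "((\<lambda>t. t * d) \<longlongrightarrow> 0 * d) (at_right (0::real))" by (intro tendsto_intros)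
    then show "((\<lambda>t. t * d) \<longlongrightarrow> 0) (at_right (0::real))" by simp
    show "\<forall>\<^sub>F t in at_right (0::real). 0 < t * d"
      using eventually_at_right_less[of 0] d by (auto elim: eventually_mono)
  qed
  from tendsto_mult_left[OF filterlim_compose[OF modulus_tendsto this], of d]
  show ?thesis by simp
qed simp

lemma eventually_small: "\<forall>\<^sub>F t in at_right 0. 0 < t \<and> t < 1 \<and> norm (t *\<^sub>R v) < R"
proof -
  have "((\<lambda>t. norm (t *\<^sub>R v)) \<longlongrightarrow> norm ((0::real) *\<^sub>R v)) (at_right 0)"
    by (intro tendsto_intros)
  then have "\<forall>\<^sub>F t in at_right 0. norm (t *\<^sub>R v) < R"
    using R by (intro order_tendstoD) auto
  moreover have "\<forall>\<^sub>F t in at_right (0::real). t \<in> {0<..<1}"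
    by (rule eventually_at_right_real) simp
  ultimately show ?thesis by eventually_elim auto
qed

text \<open>Semiconvexity between 0 and \<open>t *\<^sub>R v\<close> with weight s/t. For convex
  functions quotients are monotone; here the error depends only on the larger parameter t and
  vanishes with it.\<close>

lemma quotient_almost_mono:
  assumes "norm (t *\<^sub>R v) < R" "0 < s" "s \<le> t"
  shows "\<phi> (s *\<^sub>R v) / s \<le> \<phi> (t *\<^sub>R v) / t + norm v * \<omega> (t * norm v)"
proof -
  have t: "0 < t" "0 \<le> s / t" "s / t \<le> 1" using assms by auto
  have "\<phi> (s *\<^sub>R v) \<le> s / t * \<phi> (t *\<^sub>R v) + s / t * (1 - s / t) * (t * norm v) * \<omega> (t * norm v)"
    using scD[of "t *\<^sub>R v" 0 "s / t"] assms t R by (simp add: zero)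
  also have "\<dots> \<le> s / t * \<phi> (t *\<^sub>R v) + s / t * 1 * (t * norm v) * \<omega> (t * norm v)"
    using t modulus_nonneg[of "t * norm v"] by (intro add_left_mono mult_right_mono mult_left_mono) auto
  finally have "\<phi> (s *\<^sub>R v) \<le> s * (\<phi> (t *\<^sub>R v) / t + norm v * \<omega> (t * norm v))"
    using t by (simp add: algebra_simps)
  then show ?thesis using assms(2) by (simp add: pos_divide_le_eq mult.commute)
qed

text \<open>The limit is the infimum of quotient plus error: the vanishing error gives the lower
  estimate, and one nearly optimal t controls all smaller parameters from above.\<close>

lemma quotient_convergent: "\<exists>l. ((\<lambda>t. \<phi> (t *\<^sub>R v) / t) \<longlongrightarrow> l) (at_right 0)"
proof -
  define w where "w t = norm v * \<omega> (t * norm v)" for t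
  define A where "A = (\<lambda>t. \<phi> (t *\<^sub>R v) / t + w t) ` {t. 0 < t \<and> norm (t *\<^sub>R v) < R}"
  have w: "(w \<longlongrightarrow> 0) (at_right 0)"
    unfolding w_def by (rule modulus_scaled_tendsto) simp
  have lower: "- (L * norm v) \<le> \<phi> (t *\<^sub>R v) / t" if "0 < t" for t
  proof -
    have "- (L * norm v) * t \<le> \<phi> (t *\<^sub>R v)" using abs_le[of "t *\<^sub>R v"] that by (simp add: mult_ac)
    then show ?thesis using that by (simp add: pos_le_divide_eq)
  qed
  have bdd: "bdd_below A"
  proof (rule bdd_belowI[of _ "- (L * norm v)"])
    fix a assume "a \<in> A"
    then obtain t where t: "0 < t" "a = \<phi> (t *\<^sub>R v) / t + w t" by (auto simp: A_def)
    moreover have "0 \<le> w t" using t modulus_nonneg[of "t * norm v"] by (simp add: w_def)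
    ultimately show "- (L * norm v) \<le> a" using lower[of t] by simp
  qed
  have ne: "A \<noteq> {}"
    unfolding A_def using eventually_happens'[OF _ eventually_small[of v]] by (auto simp: trivial_limit_at_right_real)
  have "((\<lambda>t. \<phi> (t *\<^sub>R v) / t) \<longlongrightarrow> Inf A) (at_right 0)"
  proof (rule order_tendstoI)
    fix a assume "a < Inf A"
    then have "\<forall>\<^sub>F t in at_right 0. w t < Inf A - a"
      by (intro order_tendstoD[OF w]) simp
    then show "\<forall>\<^sub>F t in at_right 0. a < \<phi> (t *\<^sub>R v) / t"
      using eventually_small[of v]
    proof eventually_elim
      case (elim t)
      then have "Inf A \<le> \<phi> (t *\<^sub>R v) / t + w t" by (intro cInf_lower bdd) (auto simp: A_def)
      then show ?case using elim by simp
    qed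
  next
    fix a assume "Inf A < a"
    from cInf_lessD[OF ne this]
    obtain t where t: "0 < t" "norm (t *\<^sub>R v) < R" "\<phi> (t *\<^sub>R v) / t + w t < a"
      unfolding A_def by blast
    have "\<forall>\<^sub>F s in at_right 0. s \<in> {0<..<t}" by (rule eventually_at_right_real) fact
    then show "\<forall>\<^sub>F s in at_right 0. \<phi> (s *\<^sub>R v) / s < a"
    proof eventually_elim
      case (elim s)
      then show ?case using quotient_almost_mono[OF t(2), of s] t(3) by (simp add: w_def)
    qed
  qed
  then show ?thesis by blast
qed

definition D :: "'a \<Rightarrow> real" where
  "D v = Lim (at_right 0) (\<lambda>t. \<phi> (t *\<^sub>R v) / t)"

lemma D: "((\<lambda>t. \<phi> (t *\<^sub>R v) / t) \<longlongrightarrow> D v) (at_right 0)"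
  using quotient_convergent[of v] by (auto simp: D_def tendsto_Lim trivial_limit_at_right_real)

lemma D_zero: "D 0 = 0"
  using tendsto_unique[OF _ D[of 0]] by (simp add: zero trivial_limit_at_right_real)

lemma D_scale:
  assumes r: "0 < r"
  shows "D (r *\<^sub>R v) = r * D v"
proof -
  have "filterlim (\<lambda>t. t * r) (at_right 0) (at_right (0::real))"
  proof (rule tendsto_imp_filterlim_at_right)
    have "((\<lambda>t. t * r) \<longlongrightarrow> 0 * r) (at_right (0::real))" by (intro tendsto_intros)
    then show "((\<lambda>t. t * r) \<longlongrightarrow> 0) (at_right (0::real))" by simp
    show "\<forall>\<^sub>F t in at_right (0::real). 0 < t * r"
      using eventually_at_right_less[of 0] r by (auto elim: eventually_mono)
  qed
  from tendsto_mult_left[OF filterlim_compose[OF D[of v] this], of r]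
  have "((\<lambda>t. \<phi> (t *\<^sub>R (r *\<^sub>R v)) / t) \<longlongrightarrow> r * D v) (at_right 0)"
    using r by simp
  then show ?thesis
    using tendsto_unique[OF _ D[of "r *\<^sub>R v"]] by (simp add: trivial_limit_at_right_real)
qed

text \<open>The semiconvexity defect at scale t is t times a vanishing quantity, so it disappears
  from the quotients in the limit.\<close>

lemma convex_D: "convex_on UNIV D"
  unfolding convex_on_def
proof (intro conjI ballI allI impI)
  fix x y :: 'a and u v :: real
  assume uv: "0 \<le> u" "0 \<le> v" "u + v = 1"
  then have v: "v = 1 - u" "u \<le> 1" by auto
  let ?w = "\<lambda>t. norm (x - y) * \<omega> (t * norm (x - y))"
  have "((\<lambda>t. u * (\<phi> (t *\<^sub>R x) / t) + v * (\<phi> (t *\<^sub>R y) / t) + u * v * ?w t) \<longlongrightarrow> u * D x + v * D y + u * v * 0) (at_right 0)"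
    by (intro tendsto_intros D modulus_scaled_tendsto) auto
  moreover have "\<forall>\<^sub>F t in at_right 0. \<phi> (t *\<^sub>R (u *\<^sub>R x + v *\<^sub>R y)) / t
      \<le> u * (\<phi> (t *\<^sub>R x) / t) + v * (\<phi> (t *\<^sub>R y) / t) + u * v * ?w t"
    using eventually_small[of x] eventually_small[of y]
  proof eventually_elim
    case (elim t)
    have eq: "u *\<^sub>R (t *\<^sub>R x) + v *\<^sub>R (t *\<^sub>R y) = t *\<^sub>R (u *\<^sub>R x + v *\<^sub>R y)"
      by (simp add: algebra_simps)
    have n: "norm (t *\<^sub>R x - t *\<^sub>R y) = t * norm (x - y)"
      using elim by (simp flip: scaleR_diff_right)
    have "\<phi> (t *\<^sub>R (u *\<^sub>R x + v *\<^sub>R y)) \<le> u * \<phi> (t *\<^sub>R x) + v * \<phi> (t *\<^sub>R y) + u * v * (t * ?w t)"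
      using scD[OF elim(1)[THEN conjunct2, THEN conjunct2] elim(2)[THEN conjunct2, THEN conjunct2] uv(1) v(2)]
      unfolding v(1)[symmetric] eq n by (simp add: mult_ac)
    also have "\<dots> = (u * (\<phi> (t *\<^sub>R x) / t) + v * (\<phi> (t *\<^sub>R y) / t) + u * v * ?w t) * t"
      using elim by (simp add: field_simps)
    finally show ?case using elim by (simp add: pos_divide_le_eq)
  qed
  ultimately show "D (u *\<^sub>R x + v *\<^sub>R y) \<le> u * D x + v * D y"
    using tendsto_le[OF _ _ D[of "u *\<^sub>R x + v *\<^sub>R y"]] by (simp add: trivial_limit_at_right_real)
qed simp

lemma D_le: "norm v < R \<Longrightarrow> D v \<le> \<phi> v + norm v * \<omega> (norm v)"
  using quotient_almost_mono[of 1 v] eventually_at_right_real[of 0 "1::real"]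
  by (intro tendsto_upperbound[OF D]) (auto elim!: eventually_mono simp: trivial_limit_at_right_real)

lemma D_lipschitz: "D x \<le> D y + L * norm (x - y)"
proof (rule tendsto_le[OF _ _ D[of x]])
  show "((\<lambda>t. \<phi> (t *\<^sub>R y) / t + L * norm (x - y)) \<longlongrightarrow> D y + L * norm (x - y)) (at_right 0)"
    by (intro tendsto_intros D)
  show "\<forall>\<^sub>F t in at_right 0. \<phi> (t *\<^sub>R x) / t \<le> \<phi> (t *\<^sub>R y) / t + L * norm (x - y)"
    using eventually_at_right_less[of 0]
  proof eventually_elim
    case (elim t)
    have "norm (t *\<^sub>R x - t *\<^sub>R y) = t * norm (x - y)"
      using elim by (simp flip: scaleR_diff_right)
    then have "\<phi> (t *\<^sub>R x) \<le> \<phi> (t *\<^sub>R y) + L * (t * norm (x - y))"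
      using lipschitz_onD[OF lip, of "t *\<^sub>R x" "t *\<^sub>R y"] by (simp add: dist_norm)
    also have "\<dots> = (\<phi> (t *\<^sub>R y) / t + L * norm (x - y)) * t"
      using elim by (simp add: field_simps)
    finally show ?case using elim by (simp add: pos_divide_le_eq)
  qed
qed (simp add: trivial_limit_at_right_real)

text \<open>The pointwise limit is made uniform over directions by a finite net of the unit sphere,
  since \<phi> and \<open>D\<close> both have Lipschitz constant L.\<close>

lemma le_D_uniform:
  assumes \<epsilon>: "0 < \<epsilon>"
  shows "\<exists>\<delta>>0. \<forall>h. norm h < \<delta> \<longrightarrow> \<phi> h \<le> D h + \<epsilon> * norm h"
proof -
  \<comment> \<open>One \<open>e\<close> pays for the limit at a net point, and L e each for moving
    \<phi> and \<open>D\<close> to that point.\<close>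
  define e where "e = \<epsilon> / (2 * L + 1)"
  have "e * (2 * L + 1) = \<epsilon>" using L_nonneg by (simp add: e_def)
  then have e: "0 < e" "e + 2 * L * e = \<epsilon>"
    using \<epsilon> L_nonneg by (simp add: e_def add_nonneg_pos, argo)
  obtain N where N: "finite N" "sphere (0::'a) 1 \<subseteq> (\<Union>v\<in>N. ball v e)"
    using compact_sphere[of "0::'a" 1] e(1) unfolding compact_eq_totally_bounded by blast
  have "\<forall>\<^sub>F t in at_right 0. \<forall>v\<in>N. \<phi> (t *\<^sub>R v) / t < D v + e"
    using N(1) e(1) by (intro eventually_ball_finite ballI order_tendstoD[OF D]) auto
  then obtain \<delta> where \<delta>: "0 < \<delta>" "\<And>t v. 0 < t \<Longrightarrow> t < \<delta> \<Longrightarrow> v \<in> N \<Longrightarrow> \<phi> (t *\<^sub>R v) / t < D v + e"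
    unfolding eventually_at_right_field by auto
  show ?thesis
  proof (intro exI[of _ \<delta>] conjI allI impI \<delta>(1))
    fix h :: 'a assume h: "norm h < \<delta>"
    show "\<phi> h \<le> D h + \<epsilon> * norm h"
    proof (cases "h = 0")
      case False
      define t u where "t = norm h" and "u = h /\<^sub>R norm h"
      have t: "0 < t" "t < \<delta>" and h_eq: "h = t *\<^sub>R u" using False h by (auto simp: t_def u_def)
      have "u \<in> sphere 0 1" using False by (simp add: u_def)
      then obtain v where v: "v \<in> N" "norm (u - v) < e" using N(2) by (force simp: dist_norm norm_minus_commute)
      have 1: "\<phi> (t *\<^sub>R v) < t * (D v + e)" using \<delta>(2)[OF t v(1)] t by (simp add: pos_divide_less_eq mult.commute)
      have "norm (t *\<^sub>R u - t *\<^sub>R v) = t * norm (u - v)"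
        using t by (simp flip: scaleR_diff_right)
      then have 2: "\<phi> (t *\<^sub>R u) \<le> \<phi> (t *\<^sub>R v) + t * (L * norm (u - v))"
        using lipschitz_onD[OF lip, of "t *\<^sub>R u" "t *\<^sub>R v"] by (simp add: dist_norm mult_ac)
      have "D v \<le> D u + L * norm (u - v)" using D_lipschitz[of v u] by (simp add: norm_minus_commute)
      then have 3: "t * (D v + e) \<le> t * (D u + L * norm (u - v) + e)" using t by simp
      have "L * norm (u - v) \<le> L * e" using v(2) L_nonneg by (simp add: mult_left_mono)
      then have 4: "t * (D u + L * norm (u - v) + e + L * norm (u - v)) \<le> t * (D u + \<epsilon>)"
        using t e(2) by (intro mult_left_mono) auto
      have "\<phi> h \<le> t * (D u + \<epsilon>)"
        using 1 2 3 4 unfolding h_eq by (simp add: distrib_left)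
      moreover have "D h = t * D u" by (simp add: h_eq D_scale t)
      ultimately show ?thesis by (simp add: t_def[symmetric] algebra_simps)
    qed (simp add: zero D_zero)
  qed
qed

section \<open>The linear functions dominated by \<open>D\<close>\<close>

definition P :: "'a set" where
  "P = {p. \<forall>h. p \<bullet> h \<le> D h}"

text \<open>Take a subgradient of \<open>D\<close> at v. Testing it at 0 and at 2 v, positive
  homogeneity forces equality at v, and then its inequality is domination by \<open>D\<close>. So
  \<open>D\<close> is the support function of \<open>P\<close>.\<close>

lemma P_attains: obtains p where "p \<in> P" "p \<bullet> v = D v"
proof -
  obtain p where p: "\<And>w. D v + p \<bullet> (w - v) \<le> D w"
    using convex_on_subgradient[OF convex_D] by blast
  have "D v \<le> p \<bullet> v" using p[of 0] by (simp add: D_zero)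
  moreover have "p \<bullet> v \<le> D v" using p[of "2 *\<^sub>R v"] by (simp add: D_scale inner_diff_right)
  ultimately have "p \<bullet> v = D v" by simp
  moreover from this have "p \<in> P" using p by (simp add: P_def inner_diff_right)
  ultimately show thesis using that by blast
qed

sublocale subdiff_germ \<phi> L P
proof
  show "P \<noteq> {}" using P_attains by blast
  have "P = (\<Inter>h. {p. h \<bullet> p \<le> D h})" by (auto simp: P_def inner_commute)
  then have "closed P" "convex P"
    by (auto intro!: closed_halfspace_le convex_INT convex_halfspace_le)
  moreover have "bounded P"
  proof (rule boundedI[of _ L])
    fix p assume "p \<in> P"
    then have "p \<bullet> p \<le> D p" by (simp add: P_def)
    also have "D p \<le> L * norm p" using D_lipschitz[of p 0] by (simp add: D_zero)
    finally have "norm p * norm p \<le> L * norm p" by (simp add: dot_square_norm power2_eq_square)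
    then show "norm p \<le> L" using L_nonneg by (cases "p = 0") auto
  qed
  ultimately show "compact P" "convex P" by (auto simp: compact_eq_bounded_closed)
next
  fix \<epsilon> :: real assume \<epsilon>: "0 < \<epsilon>"
  obtain \<delta> where \<delta>: "0 < \<delta>" "\<And>h. norm h < \<delta> \<Longrightarrow> \<phi> h \<le> D h + \<epsilon> * norm h"
    using le_D_uniform[OF \<epsilon>] by blast
  have "\<forall>\<^sub>F t in at_right 0. \<omega> t < \<epsilon>"
    using \<epsilon> by (intro order_tendstoD[OF modulus_tendsto])
  then obtain \<delta>' where \<delta>': "0 < \<delta>'" "\<And>t. 0 < t \<Longrightarrow> t < \<delta>' \<Longrightarrow> \<omega> t < \<epsilon>"
    unfolding eventually_at_right_field by auto
  show "\<exists>\<delta>>0. \<forall>h. norm h < \<delta> \<longrightarrow>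
      (\<forall>p\<in>P. p \<bullet> h - \<epsilon> * norm h \<le> \<phi> h) \<and> (\<exists>p\<in>P. \<phi> h \<le> p \<bullet> h + \<epsilon> * norm h)"
  proof (intro exI[of _ "min R (min \<delta> \<delta>')"] conjI allI impI ballI)
    show "0 < min R (min \<delta> \<delta>')" using R \<delta> \<delta>' by simp
    fix h :: 'a assume h: "norm h < min R (min \<delta> \<delta>')"
    show "\<exists>p\<in>P. \<phi> h \<le> p \<bullet> h + \<epsilon> * norm h"
      using P_attains[of h] \<delta>(2)[of h] h by (metis min_less_iff_conj)
    fix p assume "p \<in> P"
    then have "p \<bullet> h \<le> \<phi> h + norm h * \<omega> (norm h)"
      using D_le[of h] h by (auto simp: P_def intro: order_trans)
    moreover have "norm h * \<omega> (norm h) \<le> norm h * \<epsilon>"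
      using \<delta>'(2)[of "norm h"] h by (cases "h = 0") (auto intro!: mult_left_mono)
    ultimately show "p \<bullet> h - \<epsilon> * norm h \<le> \<phi> h" by (simp add: mult.commute)
  qed
qed

text \<open>Conversely to \<open>D_le\<close>, apply the inequality to t h, divide by t and let t
  tend to 0. The right side has the shape of the subgradient condition on a ball.\<close>

lemma P_eq: "P = {p. \<forall>h. norm h < R \<longrightarrow> p \<bullet> h - norm h * \<omega> (norm h) \<le> \<phi> h}"
proof (intro equalityI subsetI CollectI allI impI)
  fix p h :: 'a assume "p \<in> P" "norm h < R"
  then show "p \<bullet> h - norm h * \<omega> (norm h) \<le> \<phi> h"
    using D_le[of h] by (auto simp: P_def) (smt (verit))
next
  fix p assume "p \<in> {p. \<forall>h. norm h < R \<longrightarrow> p \<bullet> h - norm h * \<omega> (norm h) \<le> \<phi> h}"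
  then have p: "\<And>h. norm h < R \<Longrightarrow> p \<bullet> h - norm h * \<omega> (norm h) \<le> \<phi> h" by blast
  have "p \<bullet> h \<le> D h" for h
  proof -
    have "((\<lambda>t. p \<bullet> h - norm h * \<omega> (t * norm h)) \<longlongrightarrow> p \<bullet> h - 0) (at_right 0)"
      by (intro tendsto_intros modulus_scaled_tendsto) auto
    moreover have "\<forall>\<^sub>F t in at_right 0. p \<bullet> h - norm h * \<omega> (t * norm h) \<le> \<phi> (t *\<^sub>R h) / t"
      using eventually_small[of h]
    proof eventually_elim
      case (elim t)
      then have "(p \<bullet> h - norm h * \<omega> (t * norm h)) * t \<le> \<phi> (t *\<^sub>R h)"
        using p[OF elim[THEN conjunct2, THEN conjunct2]] by (simp add: algebra_simps)
      then show ?case using elim by (simp add: pos_le_divide_eq)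
    qed
    ultimately show ?thesis
      using tendsto_le[OF _ D[of h]] by (auto simp: trivial_limit_at_right_real)
  qed
  then show "p \<in> P" by (simp add: P_def)
qed

text \<open>With a single slope the two halves of \<open>expansion\<close> become a first-order
  expansion. Contraposed, a singular point has a bounding ball of positive radius.\<close>

lemma P_subset_singleton_imp_derivative:
  assumes "P \<subseteq> {c}"
  shows "(\<phi> has_derivative (\<lambda>h. h \<bullet> c)) (at 0)"
  unfolding has_derivative_at_alt
proof (intro conjI allI impI)
  show "bounded_linear (\<lambda>h. h \<bullet> c)" by (rule bounded_linear_inner_left)
  fix e :: real assume "0 < e"
  from expansion[OF this] obtain \<delta> where \<delta>: "0 < \<delta>" "\<And>h. norm h < \<delta> \<Longrightarrow>
      (\<forall>p\<in>P. p \<bullet> h - e * norm h \<le> \<phi> h) \<and> (\<exists>p\<in>P. \<phi> h \<le> p \<bullet> h + e * norm h)"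
    by blast
  have c: "P = {c}" using assms P_ne by blast
  show "\<exists>d>0. \<forall>y. norm (y - 0) < d \<longrightarrow> norm (\<phi> y - \<phi> 0 - (y - 0) \<bullet> c) \<le> e * norm (y - 0)"
  proof (intro exI[of _ \<delta>] conjI allI impI \<delta>(1))
    fix y :: 'a assume "norm (y - 0) < \<delta>"
    then show "norm (\<phi> y - \<phi> 0 - (y - 0) \<bullet> c) \<le> e * norm (y - 0)"
      using \<delta>(2)[of y] by (auto simp: c zero inner_commute abs_le_iff)
  qed
qed

end

section \<open>Semiconvex functions\<close>

lemma gradient_eqI: "GDERIV F x :> D \<Longrightarrow> gradient F x = D"
  unfolding gradient_def
proof (rule the_equality)
  fix D' assume "GDERIV F x :> D" "GDERIV F x :> D'"
  then have "(\<lambda>h. h \<bullet> D) = (\<lambda>h. h \<bullet> D')"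
    unfolding gderiv_def by (rule has_derivative_unique)
  then show "D' = D" by (metis inner_commute vector_eq_rdot)
qed

text \<open>The defect of |x|^2 along a segment is exactly s(1-s)|x-y|^2. Thus the linear case falls
  under the general one with modulus \<kappa> t.\<close>

lemma linear_modulus_semiconvex_on:
  fixes f :: "'a::real_inner \<Rightarrow> real"
  assumes \<kappa>: "0 \<le> \<kappa>" and g: "convex_on K g" and f: "\<And>x. x \<in> K \<Longrightarrow> f x = g x - \<kappa> * (norm x)\<^sup>2"
  shows "semiconvex_on K (\<lambda>t. \<kappa> * t) f"
  unfolding semiconvex_on_def
proof (intro conjI ballI)
  show K: "convex K" using g by (simp add: convex_on_def)
  show "is_modulus (\<lambda>t. \<kappa> * t)"
    unfolding is_modulus_def
  proof (intro conjI allI impI)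
    show "mono_on {0..} (\<lambda>t. \<kappa> * t)" using \<kappa> by (intro mono_onI mult_left_mono)
    have lim: "((\<lambda>t. \<kappa> * t) \<longlongrightarrow> \<kappa> * t) (at t within S)" for t S by (intro tendsto_intros)
    show "((\<lambda>t. \<kappa> * t) \<longlongrightarrow> 0) (at_right 0)" using lim[of 0] by simp
    show "\<forall>\<^sub>F s in at t within {0..}. \<kappa> * s < a" if "\<kappa> * t < a" for t a
      using order_tendstoD(2)[OF lim that] .
  qed (use \<kappa> in simp)
  fix x y and s :: real assume xy: "x \<in> K" "y \<in> K" and s: "s \<in> {0..1}"
  define z where "z = s *\<^sub>R x + (1 - s) *\<^sub>R y"
  have z: "z \<in> K" unfolding z_def using K xy s by (auto simp: convex_def)
  moreover have "g z \<le> s * g x + (1 - s) * g y"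
    unfolding z_def using g xy s by (auto simp: convex_on_def)
  moreover have "s * (norm x)\<^sup>2 + (1 - s) * (norm y)\<^sup>2 - (norm z)\<^sup>2 = s * (1 - s) * (norm (x - y))\<^sup>2"
    unfolding z_def power2_norm_eq_inner by (simp add: algebra_simps inner_commute)
  then have "\<kappa> * (s * (norm x)\<^sup>2 + (1 - s) * (norm y)\<^sup>2 - (norm z)\<^sup>2) = \<kappa> * (s * (1 - s) * (norm (x - y))\<^sup>2)"
    by simp
  ultimately show "s * f x + (1 - s) * f y - f (s *\<^sub>R x + (1 - s) *\<^sub>R y) \<ge> - s * (1 - s) * norm (x - y) * (\<kappa> * norm (x - y))"
    unfolding z_def[symmetric] f[OF xy(1)] f[OF xy(2)] f[OF z] by (simp add: algebra_simps power2_eq_square)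
qed

lemma semiconvex_on_subset:
  "semiconvex_on K \<omega> f \<Longrightarrow> convex S \<Longrightarrow> S \<subseteq> K \<Longrightarrow> semiconvex_on S \<omega> f"
  unfolding semiconvex_on_def by blast

lemma semiconvex_on_shift:
  fixes f F :: "'a::real_normed_vector \<Rightarrow> real"
  assumes f: "semiconvex_on (ball x0 R) \<omega> f" and F: "\<And>x. x \<in> ball x0 R \<Longrightarrow> F x = f x"
  shows "semiconvex_on (ball 0 R) \<omega> (\<lambda>h. F (x0 + h) - F x0)"
  unfolding semiconvex_on_def
proof (intro conjI ballI)
  fix x y :: 'a and s :: real assume xy: "x \<in> ball 0 R" "y \<in> ball 0 R" and s: "s \<in> {0..1}"
  have m: "x0 + x \<in> ball x0 R" "x0 + y \<in> ball x0 R" using xy by (auto simp: dist_norm)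
  have z: "s *\<^sub>R (x0 + x) + (1 - s) *\<^sub>R (x0 + y) = x0 + (s *\<^sub>R x + (1 - s) *\<^sub>R y)"
    by (simp add: algebra_simps)
  have "x0 + (s *\<^sub>R x + (1 - s) *\<^sub>R y) \<in> ball x0 R"
    using convexD[OF convex_ball m, of s "1 - s"] s unfolding z by simp
  moreover have "s * f (x0 + x) + (1 - s) * f (x0 + y) - f (s *\<^sub>R (x0 + x) + (1 - s) *\<^sub>R (x0 + y))
      \<ge> - s * (1 - s) * norm (x0 + x - (x0 + y)) * \<omega> (norm (x0 + x - (x0 + y)))"
    using f m s unfolding semiconvex_on_def by blast
  ultimately show "s * (F (x0 + x) - F x0) + (1 - s) * (F (x0 + y) - F x0) - (F (x0 + (s *\<^sub>R x + (1 - s) *\<^sub>R y)) - F x0)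
      \<ge> - s * (1 - s) * norm (x - y) * \<omega> (norm (x - y))"
    unfolding z using m F by (simp add: algebra_simps)
qed (use f in \<open>auto simp: semiconvex_on_def\<close>)

section \<open>Both limits at a singular point\<close>

locale singular_point =
  fixes \<Omega> :: "'a::euclidean_space set" and f F :: "'a \<Rightarrow> real" and x0 :: 'a and L R :: real and \<omega> :: "real \<Rightarrow> real"
  assumes R: "0 < R" and cball: "cball x0 R \<subseteq> \<Omega>" and semiconvex: "semiconvex_on (ball x0 R) \<omega> f"
    and F: "L-lipschitz_on UNIV F" "\<And>x. x \<in> ball x0 R \<Longrightarrow> F x = f x"
    and singular: "\<not> f differentiable (at x0)"
begin

sublocale semiconvex_germ "\<lambda>h. F (x0 + h) - F x0" L R \<omega>
proof (intro semiconvex_germ.intro semiconvex_germ_axioms.intro)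
  show "lipschitz_germ (\<lambda>h. F (x0 + h) - F x0) L"
    by (rule lipschitz_germ_shift[OF F(1)])
  show "semiconvex_on (ball 0 R) \<omega> (\<lambda>h. F (x0 + h) - F x0)"
    by (rule semiconvex_on_shift[OF semiconvex F(2)])
qed (rule R)

text \<open>The ball is an admissible neighbourhood, so \<open>frechet_subdiff_eq\<close> allows
  computing with it alone; by convexity a segment from its centre stays inside exactly when its end
  does.\<close>

lemma frechet_subdiff_eq_P: "frechet_subdiff \<Omega> f x0 = P"
proof -
  have "subdiff_data \<Omega> f x0 (ball x0 R) \<omega>"
    using R cball semiconvex by (simp add: subdiff_data_def)
  moreover have "subgradient_wrt f x0 (ball x0 R) \<omega> p \<longleftrightarrow> p \<in> P" for p
  proof -
    have seg: "closed_segment x0 y \<subseteq> ball x0 R \<longleftrightarrow> y \<in> ball x0 R" for y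
      using R by (meson centre_in_ball closed_segment_subset convex_ball ends_in_segment(2) subsetD)
    have "subgradient_wrt f x0 (ball x0 R) \<omega> p \<longleftrightarrow>
        (\<forall>y\<in>ball x0 R. p \<bullet> (y - x0) - norm (y - x0) * \<omega> (norm (y - x0)) \<le> F y - F x0)"
      unfolding subgradient_wrt_def seg using F(2) R by (auto simp: algebra_simps)
    also have "\<dots> \<longleftrightarrow> (\<forall>h. norm h < R \<longrightarrow> p \<bullet> h - norm h * \<omega> (norm h) \<le> F (x0 + h) - F x0)"
    proof (intro iffI ballI allI impI)
      fix h :: 'a
      assume "\<forall>y\<in>ball x0 R. p \<bullet> (y - x0) - norm (y - x0) * \<omega> (norm (y - x0)) \<le> F y - F x0" "norm h < R"
      then show "p \<bullet> h - norm h * \<omega> (norm h) \<le> F (x0 + h) - F x0"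
        by (auto simp: dist_norm dest: bspec[of _ _ "x0 + h"])
    next
      fix y
      assume "\<forall>h. norm h < R \<longrightarrow> p \<bullet> h - norm h * \<omega> (norm h) \<le> F (x0 + h) - F x0" "y \<in> ball x0 R"
      then show "p \<bullet> (y - x0) - norm (y - x0) * \<omega> (norm (y - x0)) \<le> F y - F x0"
        by (auto simp: dist_norm norm_minus_commute dest: spec[of _ "y - x0"])
    qed
    finally show ?thesis by (simp add: P_eq)
  qed
  ultimately show ?thesis by (simp add: frechet_subdiff_eq)
qed

lemma not_P_subset_singleton: "\<not> P \<subseteq> {c}"
proof
  assume "P \<subseteq> {c}"
  then have "((\<lambda>h. F (x0 + h) - F x0) has_derivative (\<lambda>h. h \<bullet> c)) (at (- x0 + x0))"
    using P_subset_singleton_imp_derivative by simp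
  then have "((\<lambda>x. F (x0 + (- x0 + x)) - F x0) has_derivative (\<lambda>h. h \<bullet> c)) (at x0)"
    by (rule has_derivative_compose[rotated]) (auto intro!: derivative_eq_intros)
  from has_derivative_add[OF this has_derivative_const[of "F x0"]]
  have "(F has_derivative (\<lambda>h. h \<bullet> c)) (at x0)" by simp
  then have "(f has_derivative (\<lambda>h. h \<bullet> c)) (at x0)"
    by (rule has_derivative_transform_within_open[OF _ open_ball[of x0 R]]) (use R F in auto)
  then show False using singular by (auto simp: differentiable_def)
qed

lemma min_ball:
  obtains c r where "min_bounding_ball P c r" "0 < r"
    "min_bounding_radius P = r" "min_bounding_centre P = c"
proof -
  obtain c r where m: "min_bounding_ball P c r"
    using min_bounding_ball_exists[OF compact_P P_ne] .
  have "r \<noteq> 0"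
    using not_P_subset_singleton[of c] m by (auto simp: min_bounding_ball_def)
  then have "0 < r" using min_bounding_ball_radius_nonneg[OF P_ne m] by simp
  then show thesis by (rule that[OF m _ min_bounding_ball_unique[OF P_ne m]])
qed

lemma valley_transform_tendsto:
  "min_bounding_radius (frechet_subdiff \<Omega> f x0) > 0 \<and>
   ((\<lambda>\<mu>. \<mu> * valley_transform \<mu> F x0) \<longlongrightarrow> (min_bounding_radius (frechet_subdiff \<Omega> f x0))\<^sup>2 / 4) at_top"
proof -
  obtain c r where m: "min_bounding_ball P c r" "0 < r" "min_bounding_radius P = r"
    using min_ball by blast
  have "((\<lambda>\<mu>. (1/4) * - (4 * \<mu> * env \<mu> 0)) \<longlongrightarrow> (1/4) * r\<^sup>2) at_top"
    by (rule tendsto_mult_left[OF env_0_tendsto[OF m(1)]])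
  moreover have "\<forall>\<^sub>F \<mu> in at_top. (1/4) * - (4 * \<mu> * env \<mu> 0) = \<mu> * valley_transform \<mu> F x0"
    using eventually_gt_at_top[of 0]
  proof eventually_elim
    case (elim \<mu>)
    then show ?case
      using upper_transform_env[OF F(1) elim, of x0 0] by (simp add: valley_transform_def)
  qed
  ultimately have "((\<lambda>\<mu>. \<mu> * valley_transform \<mu> F x0) \<longlongrightarrow> (1/4) * r\<^sup>2) at_top"
    by (rule Lim_transform_eventually)
  then show ?thesis using m by (simp add: frechet_subdiff_eq_P)
qed

lemma upper_transform_gradient_tendsto:
  assumes g: "convex_on (ball x0 R) g" and f: "\<And>x. x \<in> ball x0 R \<Longrightarrow> f x = g x - \<kappa> * (norm x)\<^sup>2"
  shows "min_bounding_centre (frechet_subdiff \<Omega> f x0) \<in> frechet_subdiff \<Omega> f x0 \<and>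
    (\<forall>\<^sub>F \<mu> in at_top. upper_transform \<mu> F differentiable (at x0)) \<and>
    ((\<lambda>\<mu>. gradient (upper_transform \<mu> F) x0) \<longlongrightarrow> min_bounding_centre (frechet_subdiff \<Omega> f x0)) at_top"
proof -
  obtain c r where m: "min_bounding_ball P c r" "min_bounding_centre P = c"
    using min_ball by blast
  have c: "c \<in> P"
    by (rule min_bounding_ball_centre_mem[OF convex_P compact_imp_closed[OF compact_P] P_ne m(1)])
  \<comment> \<open>The convex part has non-negative second differences and the quadratic part
    contributes exactly -2 \<kappa> |h|^2; the radius R/2 keeps all three points in the
    ball.\<close>
  have second: "F (x0 + (x + h)) - F x0 + (F (x0 + (x - h)) - F x0) - 2 * (F (x0 + x) - F x0)
      \<ge> - 2 * \<kappa> * (norm h)\<^sup>2" if "norm x < R / 2" "norm h < R / 2" for x h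
  proof -
    define y z where "y = x0 + (x + h)" and "z = x0 + (x - h)"
    have "norm (y - x0) < R" "norm (z - x0) < R" "norm x < R"
      using that norm_triangle_ineq[of x h] norm_triangle_ineq4[of x h] R by (simp_all add: y_def z_def)
    then have mem: "y \<in> ball x0 R" "z \<in> ball x0 R" "x0 + x \<in> ball x0 R"
      by (simp_all add: dist_norm norm_minus_commute)
    have mid: "x0 + x = (1/2) *\<^sub>R y + (1/2) *\<^sub>R z"
      by (simp add: y_def z_def algebra_simps flip: scaleR_add_left)
    have "g (x0 + x) \<le> (1/2) * g y + (1/2) * g z"
      using convex_onD[OF g, of "1/2" y z] mem(1,2) by (simp add: mid)
    moreover have "(norm y)\<^sup>2 + (norm z)\<^sup>2 - 2 * (norm (x0 + x))\<^sup>2 = 2 * (norm h)\<^sup>2"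
      unfolding y_def z_def power2_norm_eq_inner by (simp add: algebra_simps inner_commute)
    then have "\<kappa> * ((norm y)\<^sup>2 + (norm z)\<^sup>2 - 2 * (norm (x0 + x))\<^sup>2) = \<kappa> * (2 * (norm h)\<^sup>2)" by simp
    ultimately show ?thesis
      using F(2)[OF mem(1)] F(2)[OF mem(2)] F(2)[OF mem(3)] f[OF mem(1)] f[OF mem(2)] f[OF mem(3)]
      unfolding y_def[symmetric] z_def[symmetric] by (simp add: algebra_simps)
  qed
  have diff: "\<forall>\<^sub>F \<mu> in at_top. \<exists>q. (\<forall>h. env \<mu> 0 + q \<bullet> h \<le> env \<mu> h) \<and> GDERIV (env \<mu>) 0 :> q"
    by (rule env_differentiable[of "R / 2", OF _ second]) (use R in auto)
  \<comment> \<open>The same vector must be both subgradient, for the limit, and gradient of the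
    envelope.\<close>
  define q where "q \<mu> = (SOME q. (\<forall>h. env \<mu> 0 + q \<bullet> h \<le> env \<mu> h) \<and> GDERIV (env \<mu>) 0 :> q)" for \<mu>
  have q: "\<forall>\<^sub>F \<mu> in at_top. (\<forall>h. env \<mu> 0 + q \<mu> \<bullet> h \<le> env \<mu> h) \<and> GDERIV (env \<mu>) 0 :> q \<mu>"
    using diff by (rule eventually_mono) (unfold q_def, rule someI_ex)
  have grad: "\<forall>\<^sub>F \<mu> in at_top. GDERIV (upper_transform \<mu> F) x0 :> - q \<mu>"
    using q eventually_gt_at_top[of 0]
  proof eventually_elim
    case (elim \<mu>)
    have eq: "upper_transform \<mu> F = (\<lambda>x. \<mu> * ((x - x0) \<bullet> (x - x0)) + F x0 - env \<mu> (x - x0))"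
      using upper_transform_env[OF F(1) elim(2), of x0 "_ - x0"] by (auto simp: power2_norm_eq_inner)
    have "(env \<mu> has_derivative (\<lambda>h. h \<bullet> q \<mu>)) (at (x0 - x0))"
      using elim(1) by (simp add: gderiv_def)
    then have "((\<lambda>x. env \<mu> (x - x0)) has_derivative (\<lambda>h. h \<bullet> q \<mu>)) (at x0)"
      by (rule has_derivative_compose[rotated]) (auto intro!: derivative_eq_intros)
    \<comment> \<open>The quadratic term has zero derivative at \<open>x0\<close>, which leaves
      \<open>- q \<mu>\<close>.\<close>
    then show ?case
      unfolding gderiv_def eq by (auto intro!: derivative_eq_intros)
  qed
  have "((\<lambda>\<mu>. - q \<mu>) \<longlongrightarrow> c) at_top"
    using q by (intro env_subgradient_tendsto[OF m(1)]) (auto elim: eventually_mono)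
  moreover have "\<forall>\<^sub>F \<mu> in at_top. - q \<mu> = gradient (upper_transform \<mu> F) x0"
    using grad by (rule eventually_mono) (simp add: gradient_eqI)
  ultimately have "((\<lambda>\<mu>. gradient (upper_transform \<mu> F) x0) \<longlongrightarrow> c) at_top"
    by (rule Lim_transform_eventually)
  moreover have "\<forall>\<^sub>F \<mu> in at_top. upper_transform \<mu> F differentiable (at x0)"
    using grad by (rule eventually_mono) (auto simp: gderiv_def differentiable_def)
  ultimately show ?thesis using c m(2) by (simp add: frechet_subdiff_eq_P)
qed

end

theorem theorem1p4:
  fixes \<Omega> :: "(real ^ 'n) set" and f :: "real ^ 'n \<Rightarrow> real" and x0 :: "real ^ 'n"
  assumes "open \<Omega>" and "convex \<Omega>" and "\<Omega> \<noteq> {}"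
    and "x0 \<in> \<Omega>" and "\<not> f differentiable (at x0)"
  shows
    "(locally_semiconvex_on \<Omega> f \<longrightarrow>
       (\<forall>G F. bounded G \<and> open G \<and> x0 \<in> G \<and> closure G \<subseteq> \<Omega> \<and> lipschitz_extension G f F \<longrightarrow>
          min_bounding_radius (frechet_subdiff \<Omega> f x0) > 0 \<and>
          ((\<lambda>\<mu>. \<mu> * valley_transform \<mu> F x0) \<longlongrightarrow>
             (min_bounding_radius (frechet_subdiff \<Omega> f x0))\<^sup>2 / 4) at_top)) \<and>
     (locally_linear_semiconvex_on \<Omega> f \<longrightarrow>
       (\<forall>G F. bounded G \<and> open G \<and> x0 \<in> G \<and> closure G \<subseteq> \<Omega> \<and> lipschitz_extension G f F \<longrightarrow>
          min_bounding_centre (frechet_subdiff \<Omega> f x0) \<in> frechet_subdiff \<Omega> f x0 \<and>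
          (\<forall>\<^sub>F \<mu> in at_top. upper_transform \<mu> F differentiable (at x0)) \<and>
          ((\<lambda>\<mu>. gradient (upper_transform \<mu> F) x0) \<longlongrightarrow>
             min_bounding_centre (frechet_subdiff \<Omega> f x0)) at_top))"
proof (intro conjI impI allI; elim conjE)
  fix G :: "(real ^ 'n) set" and F :: "real ^ 'n \<Rightarrow> real"
  assume G: "bounded G" "open G" "x0 \<in> G" "closure G \<subseteq> \<Omega>" "lipschitz_extension G f F"
  \<comment> \<open>This ball is convex and compact, so local semiconvexity applies to it, and every
    admissible \<open>F\<close> agrees with f on it.\<close>
  obtain R where R: "0 < R" "cball x0 R \<subseteq> G"
    using G(2,3) open_contains_cball by blast
  then have R\<Omega>: "cball x0 R \<subseteq> \<Omega>" using G(4) closure_subset by blast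
  have ball: "ball x0 R \<subseteq> cball x0 R" "ball x0 R \<subseteq> closure G"
    using R(2) closure_subset[of G] by (auto simp: subset_iff)
  have point: "singular_point \<Omega> f F x0 (lipschitz_const (closure G) f) R \<omega>"
    if "semiconvex_on (cball x0 R) \<omega> f" for \<omega>
    using R R\<Omega> ball G(5) assms(5) semiconvex_on_subset[OF that]
    by unfold_locales (auto simp: lipschitz_extension_def)
  {
    assume "locally_semiconvex_on \<Omega> f"
    then obtain \<omega> where \<omega>: "semiconvex_on (cball x0 R) \<omega> f"
      using R\<Omega> unfolding locally_semiconvex_on_def by (meson compact_cball convex_cball)
    interpret singular_point \<Omega> f F x0 "lipschitz_const (closure G) f" R \<omega>
      by (rule point[OF \<omega>])
    show "min_bounding_radius (frechet_subdiff \<Omega> f x0) > 0"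
      "((\<lambda>\<mu>. \<mu> * valley_transform \<mu> F x0) \<longlongrightarrow> (min_bounding_radius (frechet_subdiff \<Omega> f x0))\<^sup>2 / 4) at_top"
      using valley_transform_tendsto by blast+
  next
    assume "locally_linear_semiconvex_on \<Omega> f"
    then obtain \<kappa> g where g: "0 \<le> \<kappa>" "convex_on (cball x0 R) g" "\<forall>x\<in>cball x0 R. f x = g x - \<kappa> * (norm x)\<^sup>2"
      using R\<Omega> unfolding locally_linear_semiconvex_on_def by (meson compact_cball convex_cball)
    have "semiconvex_on (cball x0 R) (\<lambda>t. \<kappa> * t) f"
      using g by (intro linear_modulus_semiconvex_on) auto
    then interpret singular_point \<Omega> f F x0 "lipschitz_const (closure G) f" R "\<lambda>t. \<kappa> * t"
      by (rule point)
    have "convex_on (ball x0 R) g"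
      using convex_on_subset[OF g(2) ball(1)] by simp
    from upper_transform_gradient_tendsto[OF this, of \<kappa>] g(3)
    show "min_bounding_centre (frechet_subdiff \<Omega> f x0) \<in> frechet_subdiff \<Omega> f x0"
      "\<forall>\<^sub>F \<mu> in at_top. upper_transform \<mu> F differentiable (at x0)"
      "((\<lambda>\<mu>. gradient (upper_transform \<mu> F) x0) \<longlongrightarrow> min_bounding_centre (frechet_subdiff \<Omega> f x0)) at_top"
      by auto
  }
qed

end
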